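(* Let $b\ge 2$ be an integer and let $r>-1$ be a real number. Then for every $\epsilon>0$, \[\sum_{n_1,n_2\le x}[n_1,n_2]_b^{\,r}=C^b_{I_r,2}\frac{x^{2(r+1)}}{(r+1)^2}+O\left(x^{2(r+1)-\frac{1}{2}\min(r+1,1)+\epsilon}\right),\] where \[\begin{aligned}C^b_{I_r,2}&=\zeta^2(r+1)\,\zeta((r+1)b-r)\,\zeta(2(r+1)b-r)\prod_p\left(1-\frac{1}{p}\right)^2\left[\frac{1}{p}\left(1-\frac{1}{p^r}\right)\left(2-\frac{2}{p^{2(r+1)b-r}}-\frac{1}{p^{r+1}}+\frac{1}{p^{(r+1)b+1}}\right)\right.\\ &\qquad\left.+\left(1-\frac{1}{p^{2(r+1)b-r}}\right)\left(1-\frac{1}{p^{(r+1)b-r}}\right)\right],\end{aligned}\] the product running over all primes $p$.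
   Context: For an integer $b\ge 1$ and positive integers $n_1,n_2$, the generalized lcm is $[n_1,n_2]_b:=\min\{d\ge 1: n_1\mid d^b \text{ and } n_2\mid d^b\}$, and $[n_1,n_2]_b^{\,r}$ is its $r$-th power. Here $\zeta$ is the Riemann zeta function. The sum runs over all pairs of positive integers at most $x$, where $x$ is a real variable tending to infinity; $b$, $r$ and $\epsilon$ are fixed (the implied constant may depend on them).
   Formalization: For -1<r≤0 the stated constant fails (pole of ζ at r=0; for r<0 the prime product diverges to 0), so there ζ²(r+1) is replaced by factors (1-p^{-(r+1)})^{-2} merged into the product over primes; for r>0 the formula is as stated and the two forms agree. *)

theory Defs
  imports
    "HOL-Analysis.Analysis"
    "HOL-Computational_Algebra.Primes"
    "HOL-Library.Landau_Symbols"
begin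

definition glcm :: "nat \<Rightarrow> nat \<Rightarrow> nat \<Rightarrow> nat" where
  "glcm b n\<^sub>1 n\<^sub>2 = (LEAST d. d \<ge> 1 \<and> n\<^sub>1 dvd d ^ b \<and> n\<^sub>2 dvd d ^ b)"

definition glcm_power_sum :: "nat \<Rightarrow> real \<Rightarrow> real \<Rightarrow> real" where
  "glcm_power_sum b r x =
     (\<Sum>n\<^sub>1\<in>{1..nat \<lfloor>x\<rfloor>}. \<Sum>n\<^sub>2\<in>{1..nat \<lfloor>x\<rfloor>}. real (glcm b n\<^sub>1 n\<^sub>2) powr r)"

text \<open>The Riemann zeta function on the half-line of convergence \<open>s > 1\<close> of its Dirichlet
  series; it is only used for such \<open>s\<close>.\<close>

definition zeta :: "real \<Rightarrow> real" where
  "zeta s = (\<Sum>n. 1 / real (Suc n) powr s)"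

definition prime_bracket :: "nat \<Rightarrow> real \<Rightarrow> nat \<Rightarrow> real" where
  "prime_bracket b r p =
     1 / real p * (1 - 1 / real p powr r) *
       (2 - 2 / real p powr (2 * (r + 1) * real b - r) - 1 / real p powr (r + 1)
          + 1 / real p powr ((r + 1) * real b + 1))
     + (1 - 1 / real p powr (2 * (r + 1) * real b - r)) *
       (1 - 1 / real p powr ((r + 1) * real b - r))"

text \<open>
  The constant is \<open>\<zeta>\<^sup>2(r+1) \<zeta>((r+1)b-r) \<zeta>(2(r+1)b-r) \<Prod>\<^sub>p (1-1/p)\<^sup>2 [\<dots>]\<close>. As it stands this
  makes sense only for \<open>r > 0\<close>: for \<open>r = 0\<close> the factor \<open>\<zeta>(r+1)\<close> is at its pole, and for
  \<open>-1 < r \<le> 0\<close> the prime product, whose factors are \<open>1 - 2p\<^sup>-\<^sup>r\<^sup>-\<^sup>1 + \<dots>\<close>, diverges to 0. For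
  \<open>-1 < r \<le> 0\<close> the factor \<open>\<zeta>\<^sup>2(r+1)\<close> is therefore read as its Euler product
  \<open>\<Prod>\<^sub>p (1-p\<^sup>-\<^sup>r\<^sup>-\<^sup>1)\<^sup>-\<^sup>2\<close> and multiplied into the prime product factor by factor, which gives an
  absolutely convergent product for all \<open>r > -1\<close>. For \<open>r > 0\<close> the two expressions agree; see
  \<open>glcm_const_eq\<close> below.
\<close>

definition glcm_const :: "nat \<Rightarrow> real \<Rightarrow> real" where
  "glcm_const b r =
     (if r > 0 then
        zeta (r + 1) ^ 2 * zeta ((r + 1) * real b - r) * zeta (2 * (r + 1) * real b - r) *
        (\<Prod>p. if prime p then (1 - 1 / real p) ^ 2 * prime_bracket b r p else 1)
      else
        zeta ((r + 1) * real b - r) * zeta (2 * (r + 1) * real b - r) *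
        (\<Prod>p. if prime p
               then (1 / (1 - 1 / real p powr (r + 1))) ^ 2 *
                    ((1 - 1 / real p) ^ 2 * prime_bracket b r p)
               else 1))"


lemma zeta_has_sum:
  assumes "s > 1"
  shows "((\<lambda>n::nat. 1 / real n powr s) has_sum zeta s) {1..}"
proof -
  have sm: "summable (\<lambda>n::nat. 1 / real n powr s)"
    using assms summable_real_powr_iff[of "-s"] by (simp add: powr_minus field_simps)
  hence sm': "summable (\<lambda>n::nat. 1 / real (Suc n) powr s)"
    using summable_Suc_iff[of "\<lambda>n. 1 / real n powr s"] by blast
  hence "(\<lambda>n::nat. 1 / real (Suc n) powr s) sums zeta s"
    unfolding zeta_def by (rule summable_sums)
  hence "((\<lambda>n::nat. 1 / real (Suc n) powr s) has_sum zeta s) UNIV"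
    by (intro norm_summable_imp_has_sum) (use sm' in auto)
  moreover have "bij_betw Suc UNIV {1..}"
    by (rule bij_betwI[of _ _ _ "\<lambda>n. n - 1"]) auto
  ultimately show ?thesis
    using has_sum_reindex_bij_betw[of Suc UNIV "{1..}" "\<lambda>n. 1 / real n powr s" "zeta s"] by simp
qed

lemma zeta_sieve:
  assumes "s > 1" and "finite A" and "\<And>p. p \<in> A \<Longrightarrow> prime p"
  shows "((\<lambda>n::nat. 1 / real n powr s) has_sum (zeta s * (\<Prod>p\<in>A. 1 - 1 / real p powr s)))
           {n. n \<ge> 1 \<and> (\<forall>p\<in>A. \<not> p dvd n)}"
  using assms(2,3)
proof (induction A rule: finite_induct)
  case empty
  show ?case using zeta_has_sum[OF assms(1)] by (simp add: atLeast_def)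
next
  case (insert q A)
  define S where "S = {n. n \<ge> (1::nat) \<and> (\<forall>p\<in>A. \<not> p dvd n)}"
  define T where "T = (\<lambda>n. q * n) ` S"
  define f where "f = (\<lambda>n::nat. 1 / real n powr s)"
  define Z where "Z = zeta s * (\<Prod>p\<in>A. 1 - 1 / real p powr s)"
  have q: "prime q" and A: "\<And>p. p \<in> A \<Longrightarrow> prime p" using insert.prems by auto
  have q0: "q > 0" using q prime_gt_0_nat by blast
  have IH: "(f has_sum Z) S"
    using insert.IH A unfolding f_def Z_def S_def by auto
  have "((\<lambda>n. 1 / real q powr s * f n) has_sum (1 / real q powr s * Z)) S"
    using IH by (rule has_sum_cmult_right)
  moreover have "(\<lambda>n. 1 / real q powr s * f n) = f \<circ> (\<lambda>n. q * n)"
    by (auto simp: f_def powr_mult)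
  ultimately have "((f \<circ> (\<lambda>n. q * n)) has_sum (1 / real q powr s * Z)) S" by metis
  hence "(f has_sum (1 / real q powr s * Z)) T"
    unfolding T_def using q0 by (subst has_sum_reindex) (auto simp only: inj_on_def mult_left_cancel)
  moreover have "T \<subseteq> S"
  proof
    fix m assume "m \<in> T"
    then obtain n where n: "n \<in> S" "m = q * n" by (auto simp: T_def)
    have "\<not> p dvd m" if "p \<in> A" for p
    proof
      assume "p dvd m"
      hence "p dvd q \<or> p dvd n" using A[OF that] n by (simp add: prime_dvd_mult_iff)
      moreover have "p \<noteq> q" using that insert.hyps by auto
      ultimately show False
        using n that A[OF that] q primes_dvd_imp_eq by (auto simp: S_def)
    qed
    thus "m \<in> S" using n q0 by (auto simp: S_def)
  qed
  ultimately have "(f has_sum (Z - 1 / real q powr s * Z)) (S - T)"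
    by (intro has_sum_Diff IH)
  moreover have "S - T = {n. n \<ge> 1 \<and> (\<forall>p\<in>insert q A. \<not> p dvd n)}"
  proof -
    have "n \<in> T" if nS: "n \<in> S" and qn: "q dvd n" for n
    proof -
      obtain k where "n = q * k" using qn by (rule dvdE)
      moreover from this have "k \<in> S" using nS by (auto simp: S_def)
      ultimately show ?thesis by (auto simp: T_def)
    qed
    thus ?thesis by (auto simp: S_def T_def)
  qed
  moreover have "Z - 1 / real q powr s * Z = 
      zeta s * (\<Prod>p\<in>insert q A. 1 - 1 / real p powr s)"
    using insert.hyps by (simp add: Z_def algebra_simps)
  ultimately show ?case by (simp add: f_def)
qed

lemma prime_powr_less_1:
  assumes "prime p" "s > 0"
  shows "1 / real p powr s < 1"
proof -
  have "real p > 1" using prime_gt_1_nat[OF assms(1)] by simp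
  hence "real p powr s > 1" using assms(2) by (simp add: powr_def)
  thus ?thesis by (subst divide_less_eq_1_pos) linarith+
qed

lemma zeta_euler_product:
  assumes "s > 1"
  shows "(\<lambda>p. if prime p then 1 / (1 - 1 / real p powr s) else 1) has_prod zeta s"
proof -
  define f where "f = (\<lambda>n::nat. 1 / real n powr s)"
  define g where "g = (\<lambda>p. if prime p then 1 - 1 / real p powr s else 1)"
  have sm: "summable f"
    unfolding f_def
    using assms summable_real_powr_iff[of "-s"] by (simp add: powr_minus field_simps)
  have f0: "f n \<ge> 0" for n by (simp add: f_def)
  have hs: "(f has_sum (zeta s * (\<Prod>p\<le>N. g p))) {n. n \<ge> 1 \<and> (\<forall>p. prime p \<and> p \<le> N \<longrightarrow> \<not> p dvd n)}" for N
  proof -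
    have "(\<Prod>p\<le>N. g p) = (\<Prod>p | prime p \<and> p \<le> N. 1 - 1 / real p powr s)"
      by (rule prod.mono_neutral_cong_right) (auto simp: g_def)
    moreover have "finite {p. prime p \<and> p \<le> N}" by (rule finite_subset[of _ "{..N}"]) auto
    moreover have "{n. n \<ge> 1 \<and> (\<forall>p. prime p \<and> p \<le> N \<longrightarrow> \<not> p dvd n)} =
        {n. n \<ge> 1 \<and> (\<forall>p\<in>{p. prime p \<and> p \<le> N}. \<not> p dvd n)}"
      by blast
    ultimately show ?thesis
      using zeta_sieve[OF assms, of "{p. prime p \<and> p \<le> N}"] unfolding f_def
      by (metis (no_types, lifting) mem_Collect_eq)
  qed
  have bnd: "\<bar>zeta s * (\<Prod>p\<le>N. g p) - 1\<bar> \<le> (\<Sum>n. f (n + Suc N))" for N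
  proof -
    define S where "S = {n. n \<ge> 1 \<and> (\<forall>p. prime p \<and> p \<le> N \<longrightarrow> \<not> p dvd n)}"
    have one: "1 \<in> S" by (auto simp: S_def)
    have "(f has_sum (zeta s * (\<Prod>p\<le>N. g p) - f 1)) (S - {1})"
    proof (rule has_sum_Diff)
      show "(f has_sum (zeta s * (\<Prod>p\<le>N. g p))) S" using hs[of N] unfolding S_def .
      show "(f has_sum f 1) {1}" by (rule has_sum_finiteI) auto
      show "{1} \<subseteq> S" using one by blast
    qed
    hence 1: "(f has_sum (zeta s * (\<Prod>p\<le>N. g p) - 1)) (S - {1})" by (simp add: f_def)
    have sub: "S - {1} \<subseteq> {Suc N..}"
    proof
      fix n assume n: "n \<in> S - {1}"
      then obtain p where p: "prime p" "p dvd n" using prime_factor_nat[of n] by auto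
      hence "p > N" using n by (auto simp: S_def not_le[symmetric])
      moreover have "p \<le> n" using p n by (auto simp: S_def intro: dvd_imp_le)
      ultimately show "n \<in> {Suc N..}" by auto
    qed
    have "summable (\<lambda>n. f (n + Suc N))" using sm by (simp only: summable_iff_shift)
    hence "((\<lambda>n. f (n + Suc N)) has_sum (\<Sum>n. f (n + Suc N))) UNIV"
      using f0 by (intro norm_summable_imp_has_sum) (auto intro: summable_sums)
    moreover have "bij_betw (\<lambda>n. n + Suc N) UNIV {Suc N..}"
      by (rule bij_betwI[of _ _ _ "\<lambda>n. n - Suc N"]) auto
    ultimately have 2: "(f has_sum (\<Sum>n. f (n + Suc N))) {Suc N..}"
      using has_sum_reindex_bij_betw[of "\<lambda>n. n + Suc N" UNIV "{Suc N..}" f] by simp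
    have "zeta s * (\<Prod>p\<le>N. g p) - 1 \<le> (\<Sum>n. f (n + Suc N))"
      by (rule has_sum_mono2[OF 1 2 sub]) (use f0 in auto)
    moreover have "zeta s * (\<Prod>p\<le>N. g p) - 1 \<ge> 0"
      using 1 f0 by (rule has_sum_nonneg)
    ultimately show ?thesis by simp
  qed
  have "(\<lambda>N. \<Sum>n. f (n + Suc N)) \<longlonglongrightarrow> 0"
    using suminf_exist_split2[OF sm] LIMSEQ_Suc by blast
  hence "(\<lambda>N. zeta s * (\<Prod>p\<le>N. g p) - 1) \<longlonglongrightarrow> 0"
    by (rule Lim_null_comparison[rotated]) (use bnd in auto)
  hence lim: "(\<lambda>N. zeta s * (\<Prod>p\<le>N. g p)) \<longlonglongrightarrow> 1"
    by (simp add: LIM_zero_iff)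
  hence z0: "zeta s \<noteq> 0" by (auto simp: LIMSEQ_const_iff)
  have g0: "g p > 0" for p
    using prime_powr_less_1[of p s] assms by (auto simp: g_def)
  have "(\<lambda>N. zeta s * inverse (zeta s * (\<Prod>p\<le>N. g p))) \<longlonglongrightarrow> zeta s * inverse 1"
    by (intro tendsto_intros lim) auto
  hence "(\<lambda>N. \<Prod>p\<le>N. inverse (g p)) \<longlonglongrightarrow> zeta s"
    using z0 by (simp add: prod_dividef inverse_eq_divide)
  hence "(\<lambda>p. inverse (g p)) has_prod zeta s"
    using z0 by (simp add: has_prod_def raw_has_prod_def)
  also have "(\<lambda>p. inverse (g p)) = (\<lambda>p. if prime p then 1 / (1 - 1 / real p powr s) else 1)"
    by (auto simp: g_def inverse_eq_divide)
  finally show ?thesis .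
qed

lemma local_factor_bound:
  fixes a c u v w t :: real
  assumes "0 \<le> a" "a \<le> 1" "0 \<le> t" "t \<le> 1"
    and "0 \<le> c" "c \<le> t" "0 \<le> u" "u \<le> t" "0 \<le> v" "v \<le> t" "0 \<le> w" "w \<le> t" and "a ^ 2 \<le> t"
  shows "\<bar>(1 - a) ^ 2 * ((a - c) * (2 - 2 * u - c + w) + (1 - u) * (1 - v)) - 1\<bar> \<le> 16 * t"
proof -
  have m: "0 \<le> x * y \<and> x * y \<le> t" if "0 \<le> x" "x \<le> 1" "0 \<le> y" "y \<le> t" for x y
    using that mult_mono[of x 1 y t] by auto
  define E where "E = - 2 * (a * u) - a * c + a * w - 2 * c + 2 * (c * u) + c * c - c * w - u - v + u * v"
  have "c \<le> 1" "u \<le> 1" using assms by linarith+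
  hence ms: "0 \<le> a * u \<and> a * u \<le> t" "0 \<le> a * c \<and> a * c \<le> t" "0 \<le> a * w \<and> a * w \<le> t"
    "0 \<le> c * u \<and> c * u \<le> t" "0 \<le> c * c \<and> c * c \<le> t" "0 \<le> c * w \<and> c * w \<le> t" "0 \<le> u * v \<and> u * v \<le> t"
    using assms by (intro m; simp)+
  have E: "\<bar>E\<bar> \<le> 13 * t" unfolding E_def using ms assms by linarith
  have "(1 - a) ^ 2 * ((a - c) * (2 - 2 * u - c + w) + (1 - u) * (1 - v)) - 1
      = a ^ 2 * (2 * a - 3) + (1 - a) ^ 2 * E"
    by (simp add: E_def algebra_simps power2_eq_square)
  also have "\<bar>\<dots>\<bar> \<le> \<bar>a ^ 2 * (2 * a - 3)\<bar> + \<bar>(1 - a) ^ 2 * E\<bar>" by (rule abs_triangle_ineq)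
  also have "\<bar>a ^ 2 * (2 * a - 3)\<bar> \<le> t * 3"
    unfolding abs_mult using assms by (intro mult_mono) auto
  also have "\<bar>(1 - a) ^ 2 * E\<bar> \<le> 1 * (13 * t)"
    unfolding abs_mult using assms E by (intro mult_mono) (auto simp: power_le_one)
  finally show ?thesis by simp
qed

lemma convergent_prod_prime_bracket:
  assumes "b \<ge> 2" and "r > 0"
  shows "convergent_prod (\<lambda>p. if prime p then (1 - 1 / real p) ^ 2 * prime_bracket b r p else 1)"
    (is "convergent_prod ?F")
proof -
  define m where "m = min 2 (r + 1)"
  have m1: "m > 1" using assms by (auto simp: m_def)
  have rb: "(r + 1) * real b \<ge> (r + 1) * 2" using assms by (intro mult_left_mono) auto
  have ex: "2 * (r + 1) * real b - r \<ge> r + 1" "(r + 1) * real b - r \<ge> r + 1"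
    "(r + 1) * real b + 1 \<ge> r + 1"
    using rb assms(2) by (simp_all add: algebra_simps)
  have bound: "norm (?F p - 1) \<le> 16 * (1 / real p powr m)" for p
  proof (cases "prime p")
    case True
    hence p: "real p \<ge> 1" "p > 0" using prime_gt_0_nat[of p] by auto
    have le: "1 / real p powr y \<le> 1 / real p powr m" if "y \<ge> m" for y
      using p that by (intro divide_left_mono powr_mono) auto
    have ac: "1 / real p * (1 - 1 / real p powr r) = 1 / real p - 1 / real p powr (r + 1)"
      using p by (simp add: powr_add algebra_simps)
    have sq: "(1 / real p) ^ 2 = 1 / real p powr 2"
      using p by (simp add: power_divide powr_numeral)
    have "\<bar>(1 - 1 / real p) ^ 2 * ((1 / real p - 1 / real p powr (r + 1)) *
        (2 - 2 * (1 / real p powr (2 * (r + 1) * real b - r)) - 1 / real p powr (r + 1)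
          + 1 / real p powr ((r + 1) * real b + 1))
        + (1 - 1 / real p powr (2 * (r + 1) * real b - r)) *
          (1 - 1 / real p powr ((r + 1) * real b - r))) - 1\<bar> \<le> 16 * (1 / real p powr m)"
    proof (rule local_factor_bound)
      show "1 / real p powr m \<le> 1" using p m1 by (simp add: ge_one_powr_ge_zero)
      show "(1 / real p) ^ 2 \<le> 1 / real p powr m"
        unfolding sq by (rule le) (simp add: m_def)
      have m: "m \<le> r + 1" by (simp add: m_def)
      show "1 / real p powr (r + 1) \<le> 1 / real p powr m" by (rule le) (rule m)
      show "1 / real p powr (2 * (r + 1) * real b - r) \<le> 1 / real p powr m"
        by (rule le) (use m ex in linarith)
      show "1 / real p powr ((r + 1) * real b - r) \<le> 1 / real p powr m"
        by (rule le) (use m ex in linarith)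
      show "1 / real p powr ((r + 1) * real b + 1) \<le> 1 / real p powr m"
        by (rule le) (use m ex in linarith)
    qed (use p in auto)
    thus ?thesis
      using True unfolding prime_bracket_def ac real_norm_def by (simp only: if_True times_divide_eq_right mult_1_right)
  qed auto
  have "summable (\<lambda>p. 16 * (1 / real p powr m))"
    using m1 summable_real_powr_iff[of "-m"]
    by (intro summable_mult) (simp add: powr_minus field_simps)
  hence "summable (\<lambda>p. norm (?F p - 1))"
    by (rule summable_comparison_test_ev[rotated]) (use bound in \<open>auto intro!: always_eventually\<close>)
  hence "abs_convergent_prod ?F" by (rule summable_imp_abs_convergent_prod)
  thus ?thesis by (rule abs_convergent_prod_imp_convergent_prod)
qed

lemma glcm_const_eq:
  assumes "b \<ge> 2" and "r > -1"
  shows "glcm_const b r =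
    zeta ((r + 1) * real b - r) * zeta (2 * (r + 1) * real b - r) *
    (\<Prod>p. if prime p
           then (1 / (1 - 1 / real p powr (r + 1))) ^ 2 *
                ((1 - 1 / real p) ^ 2 * prime_bracket b r p)
           else 1)"
proof (cases "r > 0")
  case True
  let ?E = "\<lambda>p. if prime p then 1 / (1 - 1 / real p powr (r + 1)) else 1"
  let ?F = "\<lambda>p. if prime p then (1 - 1 / real p) ^ 2 * prime_bracket b r p else 1"
  have E: "?E has_prod zeta (r + 1)" using True by (intro zeta_euler_product) auto
  hence E2: "(\<lambda>p. ?E p ^ 2) has_prod (zeta (r + 1) ^ 2)" by (rule has_prod_power)
  have "zeta (r + 1) ^ 2 * (\<Prod>p. ?F p) = (\<Prod>p. ?E p ^ 2) * (\<Prod>p. ?F p)"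
    unfolding has_prod_unique[OF E2] ..
  also have "\<dots> = (\<Prod>p. ?E p ^ 2 * ?F p)"
    using E2 convergent_prod_prime_bracket[OF assms(1) True]
    by (intro prodinf_mult) (auto simp: has_prod_iff)
  also have "\<dots> = (\<Prod>p. if prime p
           then (1 / (1 - 1 / real p powr (r + 1))) ^ 2 *
                ((1 - 1 / real p) ^ 2 * prime_bracket b r p)
           else 1)"
    by (rule prodinf_cong) auto
  finally show ?thesis using True by (simp add: glcm_const_def mult_ac)
qed (simp add: glcm_const_def)

end

(*
  At a pair of prime powers (p^a, p^c) the generalized lcm is p^ceil(max a c / b), and it is
  multiplicative in the pair.  Write [n1,n2]_b^r = (n1 n2)^r times the sum of h(d1,d2) over
  d1 | n1, d2 | n2, where h is the multiplicative function whose local values are the mixed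
  differences of the local values of [n1,n2]_b^r / (n1 n2)^r.  These differences vanish in degree
  a + c = 1, so by the Euler product h(d1,d2) (d1 d2)^(-alpha) is absolutely summable for every
  alpha > 1 - min(r+1,1)/2.  Exchanging the sums gives
    sum of h(d1,d2) (d1 d2)^r M(x/d1) M(x/d2),   M(y) = sum of m^r over m <= y,
  and |M(y) - y^(r+1)/(r+1)| <= C y^(r+alpha) for all y > 0 yields the error term.  The main
  constant is the sum of h(d1,d2)/(d1 d2), whose Euler factors are geometric series over the
  square shells j b < max a c <= (j+1) b.
*)
theory Submission
  imports Defs
begin

text \<open>Division by (n1 n2)^r is the decisive normalization: as ceil(1/b) = 1, it makes all
  local values in degree 0 and 1 equal to 1, which is why degree 1 drops out. The first surviving
  local terms have degree 2 and size about p^(\<rho> - 2 \<alpha>) with \<rho> = max(0, -r), so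
  convergence over p requires 2 \<alpha> - \<rho> > 1. This is the origin of the 1/2 in the error
  exponent, because 1 - min(r+1,1)/2 = (1+\<rho>)/2. The limiting factor is thus h and not M, whose
  true error y^max(r,0) is deliberately weakened to y^(r+\<alpha>) to match the weight under which h
  is summable. The estimate for M also covers y < 1, where M vanishes. Hence d1, d2 may range over
  all positive integers, and the tail of the series for the constant is estimated together with the
  error terms by one convergent series. The geometric series over the shells have ratios p^r q^b and
  p^r q^(2b) with q = p^(-r-1), which yield the last two zeta factors; the denominator (1-q)^2 of
  the square sums yields the local form of the squared zeta factor, meaningful for every r >
  -1.\<close>

section \<open>Multiplicative functions of two variables and finite Euler products\<close>

definition pexp :: "nat \<Rightarrow> nat \<times> nat \<Rightarrow> nat \<times> nat" where
  "pexp p n = (multiplicity p (fst n), multiplicity p (snd n))"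

text \<open>Only primes dividing the product of the two entries occur, so the product is finite for
  any \<open>k\<close>. The normalization \<open>k p (0, 0) = 1\<close> is assumed where the set of
  primes gets enlarged.\<close>

definition mult_fun :: "(nat \<Rightarrow> nat \<times> nat \<Rightarrow> real) \<Rightarrow> nat \<times> nat \<Rightarrow> real" where
  "mult_fun k n = (\<Prod>p\<in>prime_factors (fst n * snd n). k p (pexp p n))"

text \<open>The exponent sets \<open>B p\<close> are kept general to serve three purposes: boxes
  given by the exponents of n1 and n2 describe divisor pairs, boxes up to \<open>N\<close> capture a
  given finite set of pairs, and \<open>UNIV\<close> gives full Euler factors.\<close>

definition smooth_pairs :: "nat set \<Rightarrow> (nat \<Rightarrow> (nat \<times> nat) set) \<Rightarrow> (nat \<times> nat) set" where
  "smooth_pairs A B = {n. fst n > 0 \<and> snd n > 0 \<and> prime_factors (fst n * snd n) \<subseteq> A \<and>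
     (\<forall>p\<in>A. pexp p n \<in> B p)}"

lemma pexp_eq_0:
  assumes "fst n > 0" "snd n > 0" "prime p" "p \<notin> prime_factors (fst n * snd n)"
  shows "pexp p n = (0, 0)"
proof -
  have "\<not> p dvd fst n * snd n" using assms by (auto simp: prime_factors_dvd)
  hence "\<not> p dvd fst n" "\<not> p dvd snd n" by auto
  thus ?thesis by (simp add: pexp_def not_dvd_imp_multiplicity_0)
qed

lemma mult_fun_eq_prod:
  assumes "finite A" "\<And>p. p \<in> A \<Longrightarrow> prime p" "fst n > 0" "snd n > 0"
    and "prime_factors (fst n * snd n) \<subseteq> A" "\<And>p. prime p \<Longrightarrow> k p (0, 0) = 1"
  shows "mult_fun k n = (\<Prod>p\<in>A. k p (pexp p n))"
  unfolding mult_fun_def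
  by (rule prod.mono_neutral_left) (use assms pexp_eq_0[of n] in auto)

lemma multiplicity_prod_powers:
  assumes "finite A" "\<And>p. p \<in> A \<Longrightarrow> prime p" "prime (p::nat)"
  shows "multiplicity p (\<Prod>q\<in>A. q ^ g q) = (if p \<in> A then g p else 0)"
  using assms by (intro multiplicity_prod_prime_powers) auto

lemma prod_powers_pos:
  assumes "\<And>p. p \<in> A \<Longrightarrow> prime (p::nat)"
  shows "(\<Prod>q\<in>A. q ^ g q) > 0"
  using assms prime_gt_0_nat by (intro prod_pos) auto

lemma eq_prod_powers:
  assumes "finite A" "\<And>p. p \<in> A \<Longrightarrow> prime p" "(n::nat) > 0" "prime_factors n \<subseteq> A"
  shows "n = (\<Prod>p\<in>A. p ^ multiplicity p n)"
proof -
  have "n = (\<Prod>p\<in>prime_factors n. p ^ multiplicity p n)"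
    using prod_prime_factors[of n] assms by simp
  also have "\<dots> = (\<Prod>p\<in>A. p ^ multiplicity p n)"
    by (rule prod.mono_neutral_left)
      (use assms in \<open>auto simp: prime_factors_multiplicity\<close>)
  finally show ?thesis .
qed

lemma bij_betw_smooth_pairs:
  assumes A: "finite A" "\<And>p. p \<in> A \<Longrightarrow> prime p"
  shows "bij_betw (\<lambda>g. (\<Prod>p\<in>A. p ^ fst (g p), \<Prod>p\<in>A. p ^ snd (g p)))
           (Pi\<^sub>E A B) (smooth_pairs A B)"
proof (rule bij_betwI[where g = "\<lambda>n. \<lambda>p\<in>A. pexp p n"])
  let ?h = "\<lambda>g. (\<Prod>p\<in>A. p ^ fst (g p), \<Prod>p\<in>A. p ^ snd (g p))"
  have pe: "pexp p (?h g) = (if p \<in> A then g p else (0, 0))" if "prime p" for p g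
    using that A multiplicity_prod_powers[of A p] by (simp add: pexp_def)
  show "?h \<in> Pi\<^sub>E A B \<rightarrow> smooth_pairs A B"
  proof
    fix g assume g: "g \<in> Pi\<^sub>E A B"
    define n where "n = ?h g"
    have pos: "fst n > 0" "snd n > 0" using prod_powers_pos A(2) by (auto simp: n_def)
    have pn: "pexp p n = (if p \<in> A then g p else (0, 0))" if "prime p" for p
      unfolding n_def by (rule pe[OF that])
    have "p \<in> A" if p: "p \<in> prime_factors (fst n * snd n)" for p
    proof (rule ccontr)
      assume "p \<notin> A"
      hence "pexp p n = (0, 0)" using pn[of p] p by (simp add: in_prime_factors_imp_prime)
      hence "multiplicity p (fst n * snd n) = 0"
        using p pos unfolding pexp_def by (subst prime_elem_multiplicity_mult_distrib) auto
      thus False using p by (simp add: prime_factors_multiplicity)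
    qed
    hence "n \<in> smooth_pairs A B"
      using pos g pn A by (auto simp: smooth_pairs_def)
    thus "?h g \<in> smooth_pairs A B" by (simp only: n_def)
  qed
  show "(\<lambda>n. \<lambda>p\<in>A. pexp p n) \<in> smooth_pairs A B \<rightarrow> Pi\<^sub>E A B"
    by (auto simp: smooth_pairs_def)
  show "(\<lambda>p\<in>A. pexp p (?h g)) = g" if "g \<in> Pi\<^sub>E A B" for g
    using that pe A by (auto simp: fun_eq_iff PiE_def extensional_def)
  show "?h (\<lambda>p\<in>A. pexp p n) = n" if n: "n \<in> smooth_pairs A B" for n
  proof -
    have "prime_factors (fst n) \<subseteq> A" "prime_factors (snd n) \<subseteq> A"
      using n by (auto simp: smooth_pairs_def prime_factors_product)
    hence "fst n = (\<Prod>p\<in>A. p ^ multiplicity p (fst n))" "snd n = (\<Prod>p\<in>A. p ^ multiplicity p (snd n))"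
      using n A by (intro eq_prod_powers; auto simp: smooth_pairs_def)+
    thus ?thesis by (simp add: pexp_def prod_eq_iff)
  qed
qed

text \<open>By unique factorization the pairs correspond to choices of one exponent pair for each
  prime in \<open>A\<close>; a finite product of absolutely convergent sums can then be multiplied
  out.\<close>

lemma infsum_mult_fun_smooth_pairs:
  assumes A: "finite A" "\<And>p. p \<in> A \<Longrightarrow> prime p"
    and k: "\<And>p. prime p \<Longrightarrow> k p (0, 0) = 1" "\<And>p. p \<in> A \<Longrightarrow> k p summable_on B p"
  shows "infsum (mult_fun k) (smooth_pairs A B) = (\<Prod>p\<in>A. infsum (k p) (B p))"
proof -
  let ?h = "\<lambda>g. (\<Prod>p\<in>A. p ^ fst (g p), \<Prod>p\<in>A. p ^ snd (g p))"
  have "(\<Prod>p\<in>A. infsum (k p) (B p)) = infsum (\<lambda>g. \<Prod>p\<in>A. k p (g p)) (Pi\<^sub>E A B)"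
    using A k by (intro infsum_prod_PiE_abs[symmetric] iffD1[OF summable_on_iff_abs_summable_on_real]) auto
  also have "\<dots> = infsum (\<lambda>g. mult_fun k (?h g)) (Pi\<^sub>E A B)"
  proof (rule infsum_cong)
    fix g assume "g \<in> Pi\<^sub>E A B"
    hence "?h g \<in> smooth_pairs A B"
      using bij_betw_smooth_pairs[OF A, where B=B] unfolding bij_betw_def by blast
    hence "mult_fun k (?h g) = (\<Prod>p\<in>A. k p (pexp p (?h g)))"
      using A k by (intro mult_fun_eq_prod) (auto simp: smooth_pairs_def)
    also have "\<dots> = (\<Prod>p\<in>A. k p (g p))"
      using A multiplicity_prod_powers[of A] by (intro prod.cong) (auto simp: pexp_def)
    finally show "(\<Prod>p\<in>A. k p (g p)) = mult_fun k (?h g)" ..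
  qed
  also have "\<dots> = infsum (mult_fun k) (smooth_pairs A B)"
    by (rule infsum_reindex_bij_betw[OF bij_betw_smooth_pairs[OF A]])
  finally show ?thesis ..
qed

lemma finite_smooth_pairs:
  assumes "finite A" "\<And>p. p \<in> A \<Longrightarrow> prime p" "\<And>p. p \<in> A \<Longrightarrow> finite (B p)"
  shows "finite (smooth_pairs A B)"
  using bij_betw_finite[OF bij_betw_smooth_pairs[OF assms(1,2), where B=B]] assms
  by (auto intro: finite_PiE)

lemma sum_mult_fun_smooth_pairs:
  assumes "finite A" "\<And>p. p \<in> A \<Longrightarrow> prime p" "\<And>p. prime p \<Longrightarrow> k p (0, 0) = 1" "\<And>p. p \<in> A \<Longrightarrow> finite (B p)"
  shows "sum (mult_fun k) (smooth_pairs A B) = (\<Prod>p\<in>A. sum (k p) (B p))"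
  using infsum_mult_fun_smooth_pairs[of A k B] finite_smooth_pairs[of A B] assms by simp

lemma divisor_pairs_eq_smooth_pairs:
  assumes n: "n\<^sub>1 > 0" "n\<^sub>2 > 0"
  shows "{d. d dvd n\<^sub>1} \<times> {d. d dvd n\<^sub>2} =
    smooth_pairs (prime_factors (n\<^sub>1 * n\<^sub>2)) (\<lambda>p. {..multiplicity p n\<^sub>1} \<times> {..multiplicity p n\<^sub>2})"
    (is "?L = ?R")
proof (intro equalityI subsetI)
  fix d assume "d \<in> ?L"
  then obtain d1 d2 where d: "d = (d1, d2)" "d1 dvd n\<^sub>1" "d2 dvd n\<^sub>2" by auto
  have pos: "d1 > 0" "d2 > 0" using d n by (auto intro!: Nat.gr0I)
  have "d1 * d2 dvd n\<^sub>1 * n\<^sub>2" using d by (intro mult_dvd_mono)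
  hence "prime_factors (d1 * d2) \<subseteq> prime_factors (n\<^sub>1 * n\<^sub>2)"
    using n by (intro dvd_prime_factors) auto
  moreover have "multiplicity p d1 \<le> multiplicity p n\<^sub>1" "multiplicity p d2 \<le> multiplicity p n\<^sub>2" for p
    using d n by (auto intro!: dvd_imp_multiplicity_le)
  ultimately show "d \<in> ?R" using pos by (auto simp: smooth_pairs_def d pexp_def)
next
  fix d assume d: "d \<in> ?R"
  have pos: "fst d > 0" "snd d > 0" using d by (auto simp: smooth_pairs_def)
  have "multiplicity p (fst d) \<le> multiplicity p n\<^sub>1 \<and> multiplicity p (snd d) \<le> multiplicity p n\<^sub>2" if "prime p" for p
  proof (cases "p \<in> prime_factors (n\<^sub>1 * n\<^sub>2)")
    case True thus ?thesis using d by (auto simp: smooth_pairs_def pexp_def)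
  next
    case False
    hence "p \<notin> prime_factors (fst d * snd d)" using d by (auto simp: smooth_pairs_def)
    thus ?thesis using pexp_eq_0[OF pos that] by (simp add: pexp_def)
  qed
  hence "fst d dvd n\<^sub>1" "snd d dvd n\<^sub>2" using pos by (auto intro!: multiplicity_le_imp_dvd)
  thus "d \<in> ?L" by (cases d) auto
qed

text \<open>The divisor sum is a finite Euler product: cut the exponents off at those of \<open>n\<^sub>1, n\<^sub>2\<close>.\<close>

lemma mult_fun_divisor_sum:
  assumes n: "n\<^sub>1 > 0" "n\<^sub>2 > 0" and k: "\<And>p. prime p \<Longrightarrow> k p (0, 0) = 1"
    and f: "\<And>p a c. f p (a, c) = (\<Sum>e\<in>{..a} \<times> {..c}. k p e)"
  shows "mult_fun f (n\<^sub>1, n\<^sub>2) = (\<Sum>d\<in>{d. d dvd n\<^sub>1} \<times> {d. d dvd n\<^sub>2}. mult_fun k d)"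
  unfolding divisor_pairs_eq_smooth_pairs[OF n]
  by (subst sum_mult_fun_smooth_pairs) (use k in \<open>auto simp: mult_fun_def pexp_def f\<close>)

lemma mult_fun_mult:
  assumes "\<And>p. prime p \<Longrightarrow> h p (pexp p n) = f p (pexp p n) * g p (pexp p n)"
  shows "mult_fun h n = mult_fun f n * mult_fun g n"
  unfolding mult_fun_def prod.distrib[symmetric] using assms by (intro prod.cong) auto

lemma mult_fun_powr:
  assumes "fst n > 0" "snd n > 0"
  shows "mult_fun (\<lambda>p e. real p powr (s * real (fst e + snd e))) n = real (fst n * snd n) powr s"
proof -
  let ?A = "prime_factors (fst n * snd n)"
  have "real (fst n * snd n) powr s = real (\<Prod>p\<in>?A. p ^ multiplicity p (fst n * snd n)) powr s"
    using assms by (subst prod_prime_factors) auto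
  also have "\<dots> = (\<Prod>p\<in>?A. real (p ^ multiplicity p (fst n * snd n)) powr s)"
    by (simp add: prod_powr_distrib)
  also have "\<dots> = (\<Prod>p\<in>?A. real p powr (s * real (fst (pexp p n) + snd (pexp p n))))"
  proof (rule prod.cong)
    fix p assume p: "p \<in> ?A"
    hence "multiplicity p (fst n * snd n) = fst (pexp p n) + snd (pexp p n)"
      unfolding pexp_def using assms by (subst prime_elem_multiplicity_mult_distrib) auto
    moreover have "real p > 0" using p prime_gt_0_nat by auto
    ultimately show "real (p ^ multiplicity p (fst n * snd n)) powr s =
        real p powr (s * real (fst (pexp p n) + snd (pexp p n)))"
      by (simp add: powr_powr powr_realpow[symmetric] mult_ac)
  qed auto
  finally show ?thesis by (simp add: mult_fun_def)
qed

section \<open>Absolute summability and infinite Euler products\<close>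

text \<open>Every finite partial sum of absolute values is at most a finite product of factors 1 + K
  p^(-\<tau>), hence at most exp(K S) with S the convergent sum of all p^(-\<tau>). Bounding finite
  local sums uniformly makes the local summability part of the hypothesis.\<close>

lemma mult_fun_summable_on:
  assumes k: "\<And>p. prime p \<Longrightarrow> k p (0, 0) = 1"
    and \<tau>: "\<tau> > 1" and K: "K \<ge> 0"
    and bound: "\<And>p B. prime p \<Longrightarrow> finite B \<Longrightarrow> (\<Sum>e\<in>B. \<bar>k p e\<bar>) \<le> 1 + K * real p powr -\<tau>"
  shows "mult_fun k summable_on {1..} \<times> {1..}"
proof -
  have sm: "summable (\<lambda>p. real p powr -\<tau>)" using \<tau> by (simp add: summable_real_powr_iff)
  define S where "S = (\<Sum>p. real p powr -\<tau>)"
  have "sum (\<lambda>n. norm (mult_fun k n)) F \<le> exp (K * S)" if F: "F \<subseteq> {1..} \<times> {1..}" "finite F" for F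
  proof -
    \<comment> \<open>The inserted 0 gives \<open>Max\<close> a nonempty argument even for empty
      \<open>F\<close>.\<close>
    define N where "N = Max (insert 0 (fst ` F \<union> snd ` F))"
    have N: "fst n \<le> N" "snd n \<le> N" if "n \<in> F" for n
      unfolding N_def using F that by (auto intro!: Max_ge)
    define A where "A = {p. prime p \<and> p \<le> N}"
    have A: "finite A" "\<And>p. p \<in> A \<Longrightarrow> prime p"
      by (auto simp: A_def intro: finite_subset[of _ "{..N}"])
    define B where "B = (\<lambda>p::nat. {..N} \<times> {..N})"
    have "F \<subseteq> smooth_pairs A B"
    proof
      fix n assume n: "n \<in> F"
      hence pos: "fst n > 0" "snd n > 0" using F by (auto simp: Suc_le_eq)
      \<comment> \<open>A crude bound suffices: exponents of numbers up to \<open>N\<close> are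
        themselves at most \<open>N\<close>, so one box works for all primes.\<close>
      have mle: "multiplicity p m \<le> m" if "prime p" "m > 0" for p m :: nat
      proof -
        have "p ^ multiplicity p m \<le> m" using that multiplicity_dvd by (intro dvd_imp_le) auto
        moreover have "multiplicity p m < p ^ multiplicity p m"
          using that by (intro power_gt_expt) (auto dest: prime_gt_1_nat)
        ultimately show ?thesis by linarith
      qed
      have "pexp p n \<in> B p" if "p \<in> A" for p
        using mle[OF A(2)[OF that] pos(1)] mle[OF A(2)[OF that] pos(2)] N[OF n]
        by (auto simp: pexp_def B_def)
      moreover have "prime_factors (fst n * snd n) \<subseteq> A"
        using pos N[OF n] by (auto simp: A_def prime_factors_product in_prime_factors_iff dest!: dvd_imp_le)
      ultimately show "n \<in> smooth_pairs A B" using pos by (auto simp: smooth_pairs_def)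
    qed
    hence "sum (\<lambda>n. norm (mult_fun k n)) F \<le> sum (\<lambda>n. norm (mult_fun k n)) (smooth_pairs A B)"
      using A by (intro sum_mono2 finite_smooth_pairs) (auto simp: B_def)
    also have "\<dots> = sum (mult_fun (\<lambda>p e. \<bar>k p e\<bar>)) (smooth_pairs A B)"
      by (simp add: mult_fun_def abs_prod)
    also have "\<dots> = (\<Prod>p\<in>A. \<Sum>e\<in>B p. \<bar>k p e\<bar>)"
      using A k by (intro sum_mult_fun_smooth_pairs) (auto simp: B_def)
    also have "\<dots> \<le> (\<Prod>p\<in>A. exp (K * real p powr -\<tau>))"
    proof (intro prod_mono conjI sum_nonneg)
      fix p assume "p \<in> A"
      hence "(\<Sum>e\<in>B p. \<bar>k p e\<bar>) \<le> 1 + K * real p powr -\<tau>" using A by (intro bound) (auto simp: B_def)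
      also have "\<dots> \<le> exp (K * real p powr -\<tau>)" by (rule exp_ge_add_one_self)
      finally show "(\<Sum>e\<in>B p. \<bar>k p e\<bar>) \<le> exp (K * real p powr -\<tau>)" .
    qed auto
    also have "\<dots> = exp (K * (\<Sum>p\<in>A. real p powr -\<tau>))"
      using A by (simp add: exp_sum sum_distrib_left)
    also have "(\<Sum>p\<in>A. real p powr -\<tau>) \<le> S"
      unfolding S_def using A sm by (intro sum_le_suminf) auto
    finally show ?thesis using K by (simp add: mult_left_mono)
  qed
  hence "bdd_above (sum (\<lambda>n. norm (mult_fun k n)) ` {F. F \<subseteq> {1..} \<times> {1..} \<and> finite F})"
    by (auto intro!: bdd_aboveI)
  hence "(\<lambda>n. norm (mult_fun k n)) summable_on {1..} \<times> {1..}"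
    unfolding abs_summable_iff_bdd_above .
  thus ?thesis by (rule abs_summable_summable)
qed

text \<open>The sets \<open>A N\<close> may be infinite, so the defining limit over finite subsets
  does not apply to them directly. Any finite set between \<open>F\<close> and \<open>A N\<close>
  has a sum within e/2 of the total, and this closed condition survives the passage to the sum over
  \<open>A N\<close>.\<close>

lemma infsum_exhaustion:
  fixes f :: "'a \<Rightarrow> real"
  assumes f: "f summable_on X" and A: "\<And>N. A N \<subseteq> X"
    and ex: "\<And>F. finite F \<Longrightarrow> F \<subseteq> X \<Longrightarrow> eventually (\<lambda>N. F \<subseteq> A N) G"
  shows "((\<lambda>N. infsum f (A N)) \<longlongrightarrow> infsum f X) G"
proof (rule tendstoI)
  fix e :: real assume e: "e > 0"
  have "e / 2 > 0" using e by simp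
  hence "eventually (\<lambda>F. dist (sum f F) (infsum f X) < e / 2) (finite_subsets_at_top X)"
    by (rule tendstoD[OF infsum_tendsto[OF f]])
  then obtain F where F: "finite F" "F \<subseteq> X"
    "\<forall>Y. finite Y \<and> F \<subseteq> Y \<and> Y \<subseteq> X \<longrightarrow> dist (sum f Y) (infsum f X) < e / 2"
    unfolding eventually_finite_subsets_at_top by (elim exE conjE) (rule that)
  show "eventually (\<lambda>N. dist (infsum f (A N)) (infsum f X) < e) G"
    using ex[OF F(1,2)]
  proof eventually_elim
    case (elim N)
    have "f summable_on A N" using f A by (rule summable_on_subset_banach)
    hence "(sum f \<longlongrightarrow> infsum f (A N)) (finite_subsets_at_top (A N))" by (rule infsum_tendsto)
    hence "((\<lambda>Y. dist (sum f Y) (infsum f X)) \<longlongrightarrow> dist (infsum f (A N)) (infsum f X)) (finite_subsets_at_top (A N))"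
      by (intro tendsto_intros)
    moreover have "eventually (\<lambda>Y. dist (sum f Y) (infsum f X) \<le> e / 2) (finite_subsets_at_top (A N))"
      unfolding eventually_finite_subsets_at_top
    proof (intro exI[of _ F] conjI allI impI)
      fix Y assume "finite Y \<and> F \<subseteq> Y \<and> Y \<subseteq> A N"
      hence "dist (sum f Y) (infsum f X) < e / 2" using F(3) A[of N] by blast
      thus "dist (sum f Y) (infsum f X) \<le> e / 2" by simp
    qed (use F elim in auto)
    ultimately have "dist (infsum f (A N)) (infsum f X) \<le> e / 2"
      by (rule tendsto_upperbound) auto
    thus ?case using e by linarith
  qed
qed

text \<open>Pairs composed of primes up to \<open>N\<close>, with all exponents allowed, exhaust the
  positive pairs. The result is a limit of partial products rather than \<open>has_prod\<close>,
  which would exclude the limit 0 when no factor vanishes.\<close>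

lemma mult_fun_euler_product:
  assumes k: "\<And>p. prime p \<Longrightarrow> k p (0, 0) = 1" "\<And>p. prime p \<Longrightarrow> k p summable_on UNIV"
    and sm: "mult_fun k summable_on {1..} \<times> {1..}"
  shows "(\<lambda>N. \<Prod>p\<le>N. if prime p then infsum (k p) UNIV else 1) \<longlonglongrightarrow> infsum (mult_fun k) ({1..} \<times> {1..})"
proof -
  define A where "A = (\<lambda>N::nat. {p. prime p \<and> p \<le> N})"
  have A: "finite (A N)" "\<And>p. p \<in> A N \<Longrightarrow> prime p" for N
    by (auto simp: A_def intro: finite_subset[of _ "{..N}"])
  have "(\<Prod>p\<le>N. if prime p then infsum (k p) UNIV else 1) = infsum (mult_fun k) (smooth_pairs (A N) (\<lambda>_. UNIV))" for N
  proof -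
    have "(\<Prod>p\<le>N. if prime p then infsum (k p) UNIV else 1) = (\<Prod>p\<in>A N. infsum (k p) UNIV)"
      by (rule prod.mono_neutral_cong_right) (auto simp: A_def)
    thus ?thesis using A k by (subst infsum_mult_fun_smooth_pairs) auto
  qed
  moreover have "(\<lambda>N. infsum (mult_fun k) (smooth_pairs (A N) (\<lambda>_. UNIV))) \<longlonglongrightarrow> infsum (mult_fun k) ({1..} \<times> {1..})"
  proof (rule infsum_exhaustion)
    show "mult_fun k summable_on {1..} \<times> {1..}" by (rule sm)
    show "smooth_pairs (A N) (\<lambda>_. UNIV) \<subseteq> {1..} \<times> {1..}" for N
      by (auto simp: smooth_pairs_def)
    fix F :: "(nat \<times> nat) set" assume F: "finite F" "F \<subseteq> {1..} \<times> {1..}"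
    show "eventually (\<lambda>N. F \<subseteq> smooth_pairs (A N) (\<lambda>_. UNIV)) sequentially"
      using eventually_ge_at_top[of "Max (insert 0 (fst ` F \<union> snd ` F))"]
    proof eventually_elim
      case (elim N)
      show ?case
      proof
        fix n assume n: "n \<in> F"
        hence pos: "fst n > 0" "snd n > 0" using F by (auto simp: Suc_le_eq)
        have "fst n \<le> Max (insert 0 (fst ` F \<union> snd ` F))" "snd n \<le> Max (insert 0 (fst ` F \<union> snd ` F))"
          using F n by (auto intro!: Max_ge)
        hence N: "fst n \<le> N" "snd n \<le> N" using elim by auto
        have "prime_factors (fst n * snd n) \<subseteq> A N"
          using pos N by (auto simp: A_def prime_factors_product in_prime_factors_iff dest!: dvd_imp_le)
        thus "n \<in> smooth_pairs (A N) (\<lambda>_. UNIV)" using pos by (auto simp: smooth_pairs_def)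
      qed
    qed
  qed
  ultimately show ?thesis by simp
qed

section \<open>Ceiling quotients and mixed differences\<close>

definition cdiv :: "nat \<Rightarrow> nat \<Rightarrow> nat" where
  "cdiv b m = (m + b - 1) div b"

text \<open>The condition on the right says that p^m divides (p^k)^b, which is how the ceiling of
  m/b enters the generalized lcm. The other facts on \<open>cdiv\<close> are read off from this
  equivalence.\<close>

lemma cdiv_le_iff: "b \<ge> 1 \<Longrightarrow> cdiv b m \<le> k \<longleftrightarrow> m \<le> k * b"
proof -
  assume b: "b \<ge> 1"
  have "cdiv b m \<le> k \<longleftrightarrow> m + b - 1 < Suc k * b"
    using b unfolding cdiv_def by (subst less_Suc_eq_le[symmetric], subst div_less_iff_less_mult) auto
  also have "\<dots> \<longleftrightarrow> m \<le> k * b" using b by auto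
  finally show ?thesis .
qed

lemma cdiv_0 [simp]: "b \<ge> 1 \<Longrightarrow> cdiv b 0 = 0"
  using cdiv_le_iff[of b 0 0] by simp

lemma cdiv_le_self: "b \<ge> 1 \<Longrightarrow> cdiv b m \<le> m"
  by (subst cdiv_le_iff) auto

lemma cdiv_pos: "b \<ge> 1 \<Longrightarrow> m > 0 \<Longrightarrow> cdiv b m \<ge> 1"
  using cdiv_le_iff[of b m 0] by linarith

lemma cdiv_eq_Suc:
  assumes "b \<ge> 1" "j * b < m" "m \<le> Suc j * b"
  shows "cdiv b m = Suc j"
  using assms cdiv_le_iff[of b m j] cdiv_le_iff[of b m "Suc j"] by linarith

lemma mult_cdiv_ge: "b \<ge> 1 \<Longrightarrow> m \<le> cdiv b m * b"
  using cdiv_le_iff[of b m "cdiv b m"] by simp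

text \<open>Backward differences in both coordinates, with value 0 at negative indices. The guards
  matter because truncated subtraction would turn index -1 into 0.\<close>

definition mixed_diff :: "(nat \<times> nat \<Rightarrow> real) \<Rightarrow> nat \<times> nat \<Rightarrow> real" where
  "mixed_diff f e = (case e of (a, c) \<Rightarrow>
     f (a, c) - (if a = 0 then 0 else f (a - 1, c)) - (if c = 0 then 0 else f (a, c - 1))
     + (if a = 0 \<or> c = 0 then 0 else f (a - 1, c - 1)))"

text \<open>The sum telescopes once in each coordinate. At every prime this is the inversion that
  makes a function of (n1, n2) a sum over divisor pairs.\<close>

lemma sum_mixed_diff: "(\<Sum>e\<in>{..a} \<times> {..c}. mixed_diff f e) = f (a, c)"
proof -
  have 1: "(\<Sum>j\<le>c. mixed_diff f (i, j)) = f (i, c) - (if i = 0 then 0 else f (i - 1, c))" for i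
    by (induction c) (auto simp: mixed_diff_def)
  have "(\<Sum>i\<le>a. f (i, c) - (if i = 0 then 0 else f (i - 1, c))) = f (a, c)"
    by (induction a) auto
  moreover have "(\<Sum>e\<in>{..a} \<times> {..c}. mixed_diff f e) = (\<Sum>i\<le>a. \<Sum>j\<le>c. mixed_diff f (i, j))"
    by (simp add: sum.cartesian_product)
  ultimately show ?thesis by (simp only: 1)
qed

lemma has_sum_shift:
  fixes g :: "nat \<times> nat \<Rightarrow> real"
  assumes "(g has_sum S) UNIV"
  shows "((\<lambda>(a, c). if a = 0 then 0 else g (a - 1, c)) has_sum S) UNIV"
    and "((\<lambda>(a, c). if c = 0 then 0 else g (a, c - 1)) has_sum S) UNIV"
proof -
  let ?f = "\<lambda>(a, c). if a = 0 then 0 else g (a - 1, c)"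
  have "(?f has_sum S) (range (\<lambda>(a, c). (Suc a, c)))"
    using assms by (subst has_sum_reindex) (auto simp: inj_on_def o_def case_prod_beta)
  thus "(?f has_sum S) UNIV"
    by (rule iffD1[OF has_sum_cong_neutral, rotated -1]) (auto simp: image_iff gr0_conv_Suc)
next
  let ?f = "\<lambda>(a, c). if c = 0 then 0 else g (a, c - 1)"
  have "(?f has_sum S) (range (\<lambda>(a, c). (a, Suc c)))"
    using assms by (subst has_sum_reindex) (auto simp: inj_on_def o_def case_prod_beta)
  thus "(?f has_sum S) UNIV"
    by (rule iffD1[OF has_sum_cong_neutral, rotated -1]) (auto simp: image_iff gr0_conv_Suc)
qed

text \<open>On generating series, a backward difference in one coordinate is multiplication by 1 -
  y; both variables are evaluated at the same y.\<close>

lemma has_sum_mixed_diff: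
  assumes "((\<lambda>e. f e * y ^ (fst e + snd e)) has_sum S) UNIV"
  shows "((\<lambda>e. mixed_diff f e * y ^ (fst e + snd e)) has_sum ((1 - y) ^ 2 * S)) UNIV"
proof -
  define g where "g = (\<lambda>e. f e * y ^ (fst e + snd e))"
  let ?s1 = "\<lambda>g (a, c). if a = 0 then 0 else g (a - 1, c)"
  let ?s2 = "\<lambda>g (a, c). if c = 0 then 0 else g (a, c - 1)"
  have g: "(g has_sum S) UNIV" using assms by (simp add: g_def)
  have "((\<lambda>e. g e + - y * ?s1 g e + - y * ?s2 g e + y ^ 2 * ?s1 (?s2 g) e) has_sum
      (S + - y * S + - y * S + y ^ 2 * S)) UNIV"
    by (intro has_sum_add has_sum_cmult_right has_sum_shift g)
  also have "S + - y * S + - y * S + y ^ 2 * S = (1 - y) ^ 2 * S"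
    by (simp add: power2_eq_square algebra_simps)
  also have "(\<lambda>e. g e + - y * ?s1 g e + - y * ?s2 g e + y ^ 2 * ?s1 (?s2 g) e) =
      (\<lambda>e. mixed_diff f e * y ^ (fst e + snd e))"
  proof
    fix e :: "nat \<times> nat"
    obtain a c where e: "e = (a, c)" by (cases e)
    show "g e + - y * ?s1 g e + - y * ?s2 g e + y ^ 2 * ?s1 (?s2 g) e =
        mixed_diff f e * y ^ (fst e + snd e)"
      unfolding e
      by (cases a; cases c) (simp_all add: g_def mixed_diff_def algebra_simps power2_eq_square)
  qed
  finally show ?thesis .
qed

section \<open>Local Euler factors as geometric series over square shells\<close>

text \<open>For nonnegative terms, convergence along one exhausting sequence is enough. Sides that
  are multiples of \<open>b\<close> are chosen because the ceiling of max(a,c)/b is constant between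
  consecutive squares.\<close>

lemma has_sum_squares:
  fixes g :: "nat \<times> nat \<Rightarrow> real"
  assumes nn: "\<And>e. g e \<ge> 0" and b: "b \<ge> 1"
    and lim: "(\<lambda>n. sum g ({..n * b} \<times> {..n * b})) \<longlonglongrightarrow> L"
  shows "(g has_sum L) UNIV"
proof -
  have ex: "\<exists>N. \<forall>n\<ge>N. F \<subseteq> {..n * b} \<times> {..n * b}" if F: "finite F" for F
  proof (intro exI allI impI subsetI)
    fix n e assume n: "n \<ge> Max (insert 0 (fst ` F \<union> snd ` F))" and e: "e \<in> F"
    have "fst e \<le> Max (insert 0 (fst ` F \<union> snd ` F))" "snd e \<le> Max (insert 0 (fst ` F \<union> snd ` F))"
      using F e by (auto intro!: Max_ge)
    moreover have "n * 1 \<le> n * b" using b by (intro mult_left_mono) auto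
    ultimately have "fst e \<le> n * b" "snd e \<le> n * b" using n by linarith+
    thus "e \<in> {..n * b} \<times> {..n * b}" by (cases e) auto
  qed
  have "incseq (\<lambda>n. sum g ({..n * b} \<times> {..n * b}))"
    by (intro monoI sum_mono2) (auto intro: nn order.trans mult_right_mono)
  hence le: "sum g ({..n * b} \<times> {..n * b}) \<le> L" for n
    using lim by (rule incseq_le)
  have "g summable_on UNIV"
  proof (rule nonneg_bdd_above_summable_on)
    have "sum g F \<le> L" if F: "finite F" for F
    proof -
      obtain n where "\<forall>m\<ge>n. F \<subseteq> {..m * b} \<times> {..m * b}" using ex[OF F] by blast
      hence n: "F \<subseteq> {..n * b} \<times> {..n * b}" by simp
      have "sum g F \<le> sum g ({..n * b} \<times> {..n * b})"
        by (rule sum_mono2) (use n nn in auto)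
      thus ?thesis using le[of n] by linarith
    qed
    thus "bdd_above (sum g ` {F. F \<subseteq> UNIV \<and> finite F})" by (auto intro!: bdd_aboveI)
  qed (use nn in auto)
  moreover have "(\<lambda>n. infsum g ({..n * b} \<times> {..n * b})) \<longlonglongrightarrow> infsum g UNIV"
    using calculation by (rule infsum_exhaustion) (use ex in \<open>auto simp: eventually_sequentially\<close>)
  hence "infsum g UNIV = L" using lim LIMSEQ_unique by simp
  ultimately show ?thesis by (simp add: has_sum_iff)
qed

text \<open>Shell j contributes z^(j+1) times a difference of squares of geometric sums. Expanding
  the squares cancels the constant 1 and leaves a part linear and a part quadratic in q^(jb), hence
  two geometric series with ratios z q^b and z q^(2b).\<close>

lemma has_sum_cdiv_max:
  fixes q z :: real
  assumes b: "b \<ge> 1" and q: "0 < q" "q < 1" and z: "z > 0" "z * q ^ b < 1"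
  shows "((\<lambda>e. z ^ cdiv b (max (fst e) (snd e)) * q ^ (fst e + snd e)) has_sum
     ((1 - q) ^ 2 + 2 * q * z * (1 - q ^ b) / (1 - z * q ^ b)
        - q ^ 2 * z * (1 - q ^ (2 * b)) / (1 - z * q ^ (2 * b))) / (1 - q) ^ 2) UNIV"
    (is "(?g has_sum ?L) UNIV")
proof (rule has_sum_squares)
  show "?g e \<ge> 0" for e using q z by auto
  define G where "G = (\<lambda>n. \<Sum>a\<le>n. q ^ a)"
  define D where "D = (\<lambda>j. z ^ Suc j * (G (Suc j * b) ^ 2 - G (j * b) ^ 2))"
  have G: "G n = (1 - q * q ^ n) / (1 - q)" for n
    using q sum_gp0[of q n] by (simp add: G_def)
  have sq: "(\<Sum>e\<in>{..n} \<times> {..n}. q ^ (fst e + snd e)) = G n ^ 2" for n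
    by (simp add: G_def power2_eq_square sum_product sum.cartesian_product power_add case_prod_beta)
  \<comment> \<open>The leading 1 is the pair (0, 0): it forms the square of side 0 and lies in no
    shell.\<close>
  have P: "sum ?g ({..n * b} \<times> {..n * b}) = 1 + (\<Sum>j<n. D j)" for n
  proof (induction n)
    case (Suc n)
    let ?A = "{..n * b} \<times> {..n * b}" and ?B = "{..Suc n * b} \<times> {..Suc n * b}"
    have sub: "?A \<subseteq> ?B" by auto
    have "sum ?g (?B - ?A) = (\<Sum>e\<in>?B - ?A. z ^ Suc n * q ^ (fst e + snd e))"
    proof (rule sum.cong)
      fix e assume "e \<in> ?B - ?A"
      hence "cdiv b (max (fst e) (snd e)) = Suc n"
        using b by (intro cdiv_eq_Suc) auto
      thus "?g e = z ^ Suc n * q ^ (fst e + snd e)" by simp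
    qed auto
    also have "\<dots> = z ^ Suc n * ((\<Sum>e\<in>?B. q ^ (fst e + snd e)) - (\<Sum>e\<in>?A. q ^ (fst e + snd e)))"
      unfolding sum_distrib_left[symmetric] by (subst sum_diff) (use sub in auto)
    also have "\<dots> = D n" unfolding sq D_def ..
    finally have "sum ?g (?B - ?A) = D n" .
    moreover have "sum ?g ?B = sum ?g ?A + sum ?g (?B - ?A)"
      using sub by (subst sum.subset_diff[of ?A ?B]) auto
    ultimately show ?case using Suc.IH by simp
  qed (use b in simp)
  have z2: "z * q ^ (2 * b) < 1" "0 \<le> z * q ^ (2 * b)"
  proof -
    have "z * q ^ (2 * b) = z * q ^ b * q ^ b" by (simp add: power_add mult_2)
    also have "\<dots> \<le> z * q ^ b * 1" using q z by (intro mult_left_mono power_le_one) auto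
    also have "\<dots> < 1" using z by simp
    finally show "z * q ^ (2 * b) < 1" .
  qed (use q z in auto)
  have D: "D j = (2 * q * z * (1 - q ^ b) * (z * q ^ b) ^ j - q ^ 2 * z * (1 - q ^ (2 * b)) * (z * q ^ (2 * b)) ^ j) / (1 - q) ^ 2" for j
  proof -
    \<comment> \<open>In terms of \<open>Q\<close> and \<open>B\<close> the shell formula becomes a
      polynomial identity.\<close>
    define Q where "Q = q ^ (j * b)"
    define B where "B = q ^ b"
    have e: "q ^ (Suc j * b) = Q * B" "(z * q ^ b) ^ j = z ^ j * Q" "(z * q ^ (2 * b)) ^ j = z ^ j * Q ^ 2"
      "q ^ (2 * b) = B ^ 2"
      by (simp_all add: Q_def B_def power_add power_mult_distrib mult_ac flip: power_mult)
    have "D j = z * z ^ j * ((1 - q * (Q * B)) ^ 2 - (1 - q * Q) ^ 2) / (1 - q) ^ 2"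
      unfolding D_def G e Q_def[symmetric] power_divide
      by (simp add: diff_divide_distrib right_diff_distrib)
    also have "z * z ^ j * ((1 - q * (Q * B)) ^ 2 - (1 - q * Q) ^ 2) =
        2 * q * z * (1 - B) * (z ^ j * Q) - q ^ 2 * z * (1 - B ^ 2) * (z ^ j * Q ^ 2)"
      by (simp add: power2_eq_square algebra_simps)
    finally show ?thesis unfolding e(2,3) unfolding e(4) unfolding B_def[symmetric] .
  qed
  have "D sums ((2 * q * z * (1 - q ^ b) * (1 / (1 - z * q ^ b))
      - q ^ 2 * z * (1 - q ^ (2 * b)) * (1 / (1 - z * q ^ (2 * b)))) / (1 - q) ^ 2)"
    unfolding D using z2 z q
    by (intro sums_divide sums_diff sums_mult geometric_sums) auto
  hence "(\<lambda>n. 1 + (\<Sum>j<n. D j)) \<longlonglongrightarrow> 1 + (2 * q * z * (1 - q ^ b) * (1 / (1 - z * q ^ b))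
      - q ^ 2 * z * (1 - q ^ (2 * b)) * (1 / (1 - z * q ^ (2 * b)))) / (1 - q) ^ 2"
    unfolding sums_def by (intro tendsto_intros)
  also have "1 + (2 * q * z * (1 - q ^ b) * (1 / (1 - z * q ^ b))
      - q ^ 2 * z * (1 - q ^ (2 * b)) * (1 / (1 - z * q ^ (2 * b)))) / (1 - q) ^ 2 = ?L"
    using q by (simp add: add_divide_distrib diff_divide_distrib)
  finally show "(\<lambda>n. sum ?g ({..n * b} \<times> {..n * b})) \<longlonglongrightarrow> ?L" unfolding P .
qed (use b in simp)

text \<open>The value of \<open>[n\<^sub>1,n\<^sub>2]\<^sub>b\<^sup>r / (n\<^sub>1 n\<^sub>2)\<^sup>r\<close> at \<open>(p\<^sup>a, p\<^sup>c)\<close>, where \<open>e = (a, c)\<close>.\<close>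

definition local_quot :: "nat \<Rightarrow> real \<Rightarrow> nat \<Rightarrow> nat \<times> nat \<Rightarrow> real" where
  "local_quot b r p e =
     real p powr (r * (real (cdiv b (max (fst e) (snd e))) - real (fst e + snd e)))"

lemma has_sum_local_factor:
  assumes b: "b \<ge> 2" and r: "r > -1" and p: "prime p"
  shows "((\<lambda>e. mixed_diff (local_quot b r p) e * real p powr (- 1 * real (fst e + snd e))) has_sum
      (1 / (1 - 1 / real p powr ((r + 1) * real b - r)) *
       (1 / (1 - 1 / real p powr (2 * (r + 1) * real b - r))) *
       ((1 / (1 - 1 / real p powr (r + 1))) ^ 2 * ((1 - 1 / real p) ^ 2 * prime_bracket b r p)))) UNIV"
proof -
  have p1: "real p > 1" using prime_gt_1_nat[OF p] by simp
  \<comment> \<open>With these \<open>q\<close> and \<open>z\<close> the local quotient times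
    p^(-(a+c)) is z^ceil(max(a,c)/b) q^(a+c), and \<open>u\<close>, \<open>v\<close> are the local
    variables of the last two zeta factors.\<close>
  define q where "q = real p powr (- (r + 1))"
  define z where "z = real p powr r"
  define u where "u = z * q ^ (2 * b)"
  define v where "v = z * q ^ b"
  have rb: "(r + 1) * real b \<ge> (r + 1) * 2" using assms by (intro mult_left_mono) auto
  have q': "1 / real p powr (r + 1) = q" unfolding q_def by (rule powr_minus_divide[symmetric])
  have q: "0 < q" "q < 1" using prime_powr_less_1[OF p, of "r + 1"] r p1 unfolding q' by (auto simp: q_def)
  have z: "z > 0" using p1 by (simp add: z_def)
  have qn: "q ^ n = real p powr (- ((r + 1) * real n))" for n
    using p1 by (simp add: q_def powr_powr algebra_simps flip: powr_realpow)
  have u: "u = 1 / real p powr (2 * (r + 1) * real b - r)"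
    unfolding u_def qn z_def by (simp add: powr_add[symmetric] powr_minus_divide[symmetric] algebra_simps)
  have v: "v = 1 / real p powr ((r + 1) * real b - r)"
    unfolding v_def qn z_def by (simp add: powr_add[symmetric] powr_minus_divide[symmetric] algebra_simps)
  have v1: "v < 1" unfolding v using rb r p by (intro prime_powr_less_1) (auto simp: algebra_simps)
  have u1: "u < 1" unfolding u using rb r p by (intro prime_powr_less_1) (auto simp: algebra_simps)
  have qz: "q * z = 1 / real p"
    using p1 by (simp add: q_def z_def powr_add[symmetric] powr_minus_divide)
  have w: "1 / real p powr ((r + 1) * real b + 1) = q * v"
    unfolding q_def v using p1
    by (simp add: powr_add[symmetric] powr_minus_divide[symmetric] algebra_simps)
  have z': "1 / real p powr r = 1 / z" by (simp add: z_def)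
  have yn: "(1 / real p) ^ n = real p powr (- real n)" for n
    using p1 by (simp add: power_one_over powr_minus_divide powr_realpow)
  define L where "L = ((1 - q) ^ 2 + 2 * q * z * (1 - q ^ b) / (1 - v)
        - q ^ 2 * z * (1 - q ^ (2 * b)) / (1 - u)) / (1 - q) ^ 2"
  have "((\<lambda>e. z ^ cdiv b (max (fst e) (snd e)) * q ^ (fst e + snd e)) has_sum L) UNIV"
    unfolding L_def u_def v_def by (rule has_sum_cdiv_max) (use q z v1 b in \<open>auto simp: v_def\<close>)
  also have "(\<lambda>e. z ^ cdiv b (max (fst e) (snd e)) * q ^ (fst e + snd e)) =
      (\<lambda>e. local_quot b r p e * (1 / real p) ^ (fst e + snd e))"
  proof
    fix e :: "nat \<times> nat"
    have "z ^ cdiv b (max (fst e) (snd e)) = real p powr (r * real (cdiv b (max (fst e) (snd e))))"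
      using p1 by (simp add: z_def powr_powr flip: powr_realpow)
    thus "z ^ cdiv b (max (fst e) (snd e)) * q ^ (fst e + snd e) =
        local_quot b r p e * (1 / real p) ^ (fst e + snd e)"
      unfolding qn yn local_quot_def by (simp only: powr_add[symmetric]) (simp add: algebra_simps)
  qed
  finally have "((\<lambda>e. mixed_diff (local_quot b r p) e * (1 / real p) ^ (fst e + snd e)) has_sum
      ((1 - 1 / real p) ^ 2 * L)) UNIV" by (rule has_sum_mixed_diff)
  also have "(\<lambda>e. mixed_diff (local_quot b r p) e * (1 / real p) ^ (fst e + snd e)) =
      (\<lambda>e. mixed_diff (local_quot b r p) e * real p powr (- 1 * real (fst e + snd e)))"
    by (simp only: yn mult_minus1)
  also have "(1 - 1 / real p) ^ 2 * L = 1 / (1 - v) * (1 / (1 - u)) * ((1 / (1 - q)) ^ 2 * ((1 - 1 / real p) ^ 2 * prime_bracket b r p))"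
  proof -
    \<comment> \<open>Clears the denominators 1 - v and 1 - u of the two geometric series.\<close>
    have cancel: "x * y * (A + B / y - C / x) = A * x * y + B * x - C * y"
      if "x \<noteq> 0" "y \<noteq> 0" for A B C x y :: real
      using that by (simp add: field_simps)
    have "1 / real p * (1 - 1 / z) = q * (z - 1)" using z by (simp add: qz[symmetric] field_simps)
    hence "prime_bracket b r p = q * (z - 1) * (2 - 2 * u - q + q * v) + (1 - u) * (1 - v)"
      unfolding prime_bracket_def w q' z' by (simp add: u v)
    \<comment> \<open>A polynomial identity in independent \<open>q\<close>, \<open>z\<close>,
      \<open>u\<close>, \<open>v\<close>; the relations between them enter only when z - v and z - u
      are factored below.\<close>
    also have "\<dots> = (1 - q) ^ 2 * (1 - u) * (1 - v) + 2 * q * (z - v) * (1 - u) - q ^ 2 * (z - u) * (1 - v)"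
      by (simp add: algebra_simps power2_eq_square)
    also have "\<dots> = (1 - u) * (1 - v) * ((1 - q) ^ 2 + 2 * q * (z - v) / (1 - v) - q ^ 2 * (z - u) / (1 - u))"
      using u1 v1 by (subst cancel) auto
    also have "2 * q * (z - v) = 2 * q * z * (1 - q ^ b)" by (simp add: v_def algebra_simps)
    also have "q ^ 2 * (z - u) = q ^ 2 * z * (1 - q ^ (2 * b))" by (simp add: u_def algebra_simps)
    also have "(1 - q) ^ 2 + 2 * q * z * (1 - q ^ b) / (1 - v) - q ^ 2 * z * (1 - q ^ (2 * b)) / (1 - u) = (1 - q) ^ 2 * L"
      using q by (simp add: L_def)
    finally have br: "prime_bracket b r p = (1 - u) * (1 - v) * ((1 - q) ^ 2 * L)" .
    have "A * L = 1 / y * (1 / x) * ((1 / w) ^ 2 * (A * (x * y * (w ^ 2 * L))))"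
      if "x \<noteq> 0" "y \<noteq> 0" "w \<noteq> 0" for A x y w :: real
      using that by (simp add: field_simps)
    thus ?thesis unfolding br using u1 v1 q by (simp add: power_divide)
  qed
  finally show ?thesis unfolding u v q' .
qed

section \<open>Size of the mixed differences\<close>

lemma local_quot_le:
  assumes "b \<ge> 1" "real p \<ge> 1" "fst e + snd e \<le> Suc k"
  shows "local_quot b r p e \<le> real p powr (max 0 (-r) * real k)"
proof -
  let ?m = "max (fst e) (snd e)" and ?s = "fst e + snd e"
  have "r * (real (cdiv b ?m) - real ?s) \<le> max 0 (-r) * real k"
  proof (cases "r \<ge> 0")
    case True
    have "cdiv b ?m \<le> ?s" using cdiv_le_self[of b ?m] assms by linarith
    hence "r * (real (cdiv b ?m) - real ?s) \<le> 0" using True by (intro mult_nonneg_nonpos) auto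
    thus ?thesis using True by simp
  next
    case False
    have "real ?s - real (cdiv b ?m) \<le> real k"
    proof (cases "?m = 0")
      case False
      thus ?thesis using cdiv_pos[of b ?m] assms by linarith
    qed (use assms in auto)
    hence "(-r) * (real ?s - real (cdiv b ?m)) \<le> (-r) * real k" using False by (intro mult_left_mono) auto
    thus ?thesis using False by (simp add: algebra_simps)
  qed
  thus ?thesis unfolding local_quot_def using assms by (intro powr_mono) auto
qed

lemma mixed_diff_local_quot_0:
  assumes "b \<ge> 1" "real p > 0"
  shows "mixed_diff (local_quot b r p) (0, 0) = 1"
  using assms by (simp add: mixed_diff_def local_quot_def)

text \<open>At (1, 0) and (0, 1) the quotient is p^(r(1-1)) = 1, the same as at (0, 0).\<close>

lemma mixed_diff_local_quot_1:
  assumes "b \<ge> 1" "real p > 0" "fst e + snd e = 1"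
  shows "mixed_diff (local_quot b r p) e = 0"
proof -
  have "cdiv b 1 = 1" using cdiv_eq_Suc[of b 0 1] assms by simp
  moreover have "e = (0, 1) \<or> e = (1, 0)" using assms(3) by (cases e) auto
  ultimately show ?thesis using assms by (auto simp: mixed_diff_def local_quot_def)
qed

lemma abs_mixed_diff_local_quot_le:
  assumes "b \<ge> 1" "real p \<ge> 1" "fst e + snd e = Suc k"
  shows "\<bar>mixed_diff (local_quot b r p) e\<bar> \<le> 4 * real p powr (max 0 (-r) * real k)"
proof -
  obtain a c where e: "e = (a, c)" by (cases e)
  have ac: "a + c = Suc k" using assms e by simp
  define M where "M = real p powr (max 0 (-r) * real k)"
  have l: "0 \<le> local_quot b r p e' \<and> local_quot b r p e' \<le> M" if "fst e' + snd e' \<le> Suc k" for e'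
    unfolding M_def using local_quot_le[OF assms(1,2) that] by (simp add: local_quot_def)
  have M0: "M \<ge> 0" by (simp add: M_def)
  have "\<bar>(x::real) - x1 - x2 + x3\<bar> \<le> 4 * M"
    if "0 \<le> x \<and> x \<le> M" "0 \<le> x1 \<and> x1 \<le> M" "0 \<le> x2 \<and> x2 \<le> M" "0 \<le> x3 \<and> x3 \<le> M" for x x1 x2 x3
    using that by linarith
  hence "\<bar>mixed_diff (local_quot b r p) (a, c)\<bar> \<le> 4 * M"
    unfolding mixed_diff_def prod.case by this (use l M0 ac in auto)
  thus ?thesis by (simp add: e M_def)
qed

text \<open>
  Since degree 1 does not contribute, the sum over \<open>e \<noteq> (0, 0)\<close> is dominated by degree 2, where
  each term is at most \<open>4 p\<^sup>\<rho> p\<^sup>-\<^sup>2\<^sup>\<alpha> = 4 p\<^sup>-\<^sup>1\<^sup>-\<^sup>2\<^sup>\<delta>\<close>; the higher degrees decay geometrically.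
\<close>

lemma sum_mixed_diff_local_quot_bound:
  assumes b: "b \<ge> 1" and r: "r > -1" and \<delta>: "\<delta> > 0"
  defines "\<rho> \<equiv> max 0 (-r)"
  defines "\<alpha> \<equiv> (1 + \<rho>) / 2 + \<delta>"
  shows "\<exists>K\<ge>0. \<forall>p B. prime p \<longrightarrow> finite B \<longrightarrow>
    (\<Sum>e\<in>B. \<bar>mixed_diff (local_quot b r p) e * real p powr (- \<alpha> * real (fst e + snd e))\<bar>)
      \<le> 1 + K * real p powr - (1 + 2 * \<delta>)"
proof -
  \<comment> \<open>\<eta> is \<alpha> - \<rho>, the decay exponent per degree; \<open>t\<close> is
    that decay at the smallest prime 2, the worst case.\<close>
  define \<eta> where "\<eta> = (1 - \<rho>) / 2 + \<delta>"
  define t where "t = (2::real) powr - \<eta>"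
  have \<rho>: "0 \<le> \<rho>" "\<rho> < 1" using r by (auto simp: \<rho>_def)
  have \<eta>: "\<eta> > 0" using \<rho> \<delta> by (simp add: \<eta>_def add_pos_pos)
  have t: "0 < t" "t < 1" using \<eta> by (auto simp: t_def powr_minus field_simps)
  \<comment> \<open>4 bounds the four terms of a mixed difference, 2^(2\<eta>) makes up for counting
    the decay from degree 0 instead of 2, and the square comes from the double geometric
    series.\<close>
  define K where "K = 4 * 2 powr (2 * \<eta>) * (1 / (1 - t)) ^ 2"
  have "(\<Sum>e\<in>B. \<bar>mixed_diff (local_quot b r p) e * real p powr (- \<alpha> * real (fst e + snd e))\<bar>)
      \<le> 1 + K * real p powr - (1 + 2 * \<delta>)" if p: "prime p" and B: "finite B" for p B
  proof -
    let ?T = "\<lambda>e. \<bar>mixed_diff (local_quot b r p) e * real p powr (- \<alpha> * real (fst e + snd e))\<bar>"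
    define P where "P = real p powr - (1 + 2 * \<delta>)"
    have p2: "real p \<ge> 2" using prime_ge_2_nat[OF p] by simp
    have P0: "P \<ge> 0" by (simp add: P_def)
    have term_le: "?T e \<le> (if e = (0, 0) then 1 else 0) + 4 * P * 2 powr (2 * \<eta>) * t ^ (fst e + snd e)" for e
    proof -
      consider "e = (0, 0)" | "fst e + snd e = 1" | k where "fst e + snd e = Suc (Suc k)"
        by (cases e) (metis add_is_0 fst_conv snd_conv not0_implies_Suc One_nat_def)
      thus ?thesis
      proof cases
        case 1
        thus ?thesis using mixed_diff_local_quot_0[OF b, of p r] p2 P0 by simp
      next
        case 2
        thus ?thesis using mixed_diff_local_quot_1[OF b _ 2, of p r] p2 P0 t by (auto simp: add_nonneg_nonneg)
      next
        case (3 k)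
        have "?T e \<le> 4 * real p powr (\<rho> * real (Suc k)) * real p powr (- \<alpha> * real (Suc (Suc k)))"
          unfolding abs_mult 3 \<rho>_def using p2
          by (intro mult_mono abs_mixed_diff_local_quot_le b) (use 3 in auto)
        \<comment> \<open>Degree k + 2 has exponent \<rho>(k+1) - \<alpha>(k+2): its value at k = 0
          is -(1+2\<delta>) and its slope is -\<eta>.\<close>
        also have "\<dots> = 4 * real p powr (- (1 + 2 * \<delta>) + (- \<eta> * real k))"
          by (simp add: powr_add[symmetric] \<alpha>_def \<eta>_def field_simps)
        also have "\<dots> = 4 * P * real p powr (- \<eta> * real k)"
          by (simp only: powr_add P_def mult.assoc)
        also have "\<dots> \<le> 4 * P * 2 powr (- \<eta> * real k)"
          using p2 P0 \<eta> by (intro mult_left_mono powr_mono2') (auto simp: mult_nonneg_nonneg)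
        also have "2 powr (- \<eta> * real k) = 2 powr (2 * \<eta>) * (2 powr (- \<eta> * real (fst e + snd e)) :: real)"
          unfolding 3 by (simp add: powr_add[symmetric] algebra_simps)
        also have "2 powr (- \<eta> * real (fst e + snd e)) = t ^ (fst e + snd e)"
          unfolding t_def by (simp only: powr_powr[symmetric] powr_realpow[of "2 powr - \<eta>"] powr_gt_zero)
        finally have "?T e \<le> 4 * P * (2 powr (2 * \<eta>) * t ^ (fst e + snd e))" .
        moreover have "e \<noteq> (0, 0)" using 3 by auto
        ultimately show ?thesis by (simp add: mult.assoc)
      qed
    qed
    define N where "N = Max (insert 0 (fst ` B \<union> snd ` B))"
    have BN: "B \<subseteq> {..N} \<times> {..N}"
    proof
      fix e assume "e \<in> B"
      hence "fst e \<le> N" "snd e \<le> N" using B by (auto simp: N_def intro!: Max_ge)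
      thus "e \<in> {..N} \<times> {..N}" by (cases e) auto
    qed
    have "(\<Sum>e\<in>B. t ^ (fst e + snd e)) \<le> (\<Sum>e\<in>{..N} \<times> {..N}. t ^ (fst e + snd e))"
      by (rule sum_mono2) (use BN t in auto)
    also have "\<dots> = (\<Sum>a\<le>N. t ^ a) ^ 2"
      by (simp add: power2_eq_square sum_product sum.cartesian_product power_add case_prod_beta)
    also have "\<dots> \<le> (1 / (1 - t)) ^ 2"
      using t by (intro power_mono sum_nonneg) (auto simp: sum_gp0 divide_right_mono)
    finally have tB: "(\<Sum>e\<in>B. t ^ (fst e + snd e)) \<le> (1 / (1 - t)) ^ 2" .
    have "sum ?T B \<le> (\<Sum>e\<in>B. (if e = (0, 0) then 1 else 0) + 4 * P * 2 powr (2 * \<eta>) * t ^ (fst e + snd e))"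
      by (rule sum_mono) (rule term_le)
    also have "\<dots> = (\<Sum>e\<in>B. if e = (0, 0) then 1 else 0) + 4 * P * 2 powr (2 * \<eta>) * (\<Sum>e\<in>B. t ^ (fst e + snd e))"
      by (simp add: sum.distrib sum_distrib_left)
    also have "(\<Sum>e\<in>B. if e = (0, 0) then 1 else (0::real)) \<le> 1" using B by simp
    also have "4 * P * 2 powr (2 * \<eta>) * (\<Sum>e\<in>B. t ^ (fst e + snd e)) \<le> 4 * P * 2 powr (2 * \<eta>) * (1 / (1 - t)) ^ 2"
      using P0 by (intro mult_left_mono tB) auto
    finally show ?thesis by (simp add: K_def P_def mult_ac)
  qed
  moreover have "K \<ge> 0" by (simp add: K_def)
  ultimately show ?thesis by blast
qed

section \<open>Power sums\<close>

definition powr_sum :: "real \<Rightarrow> real \<Rightarrow> real" where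
  "powr_sum r y = (\<Sum>m\<in>{1..nat \<lfloor>y\<rfloor>}. real m powr r)"

lemma powr_primitive_mvt:
  assumes "(r::real) > -1" "t > 0"
  obtains \<xi> where "t < \<xi>" "\<xi> < t + 1" "(t + 1) powr (r + 1) / (r + 1) - t powr (r + 1) / (r + 1) = \<xi> powr r"
proof -
  have "\<exists>\<xi>. t < \<xi> \<and> \<xi> < t + 1 \<and> (t + 1) powr (r + 1) / (r + 1) - t powr (r + 1) / (r + 1) =
      (t + 1 - t) * \<xi> powr r"
  proof (rule MVT2)
    fix x assume "t \<le> x" "x \<le> t + 1"
    hence x: "x > 0" using assms by linarith
    have "((\<lambda>y. y powr (r + 1) / (r + 1)) has_real_derivative ((r + 1) * x powr (r + 1 - 1)) / (r + 1)) (at x)"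
      using x by (intro DERIV_cdivide has_real_derivative_powr)
    thus "((\<lambda>y. y powr (r + 1) / (r + 1)) has_real_derivative x powr r) (at x)"
      using assms by simp
  qed simp
  thus ?thesis using that by auto
qed

text \<open>Integral comparison on unit increments of the primitive: the mean value theorem writes
  each one as \<xi>^r, and monotonicity compares \<xi> with an end point.\<close>

lemma powr_sum_nonneg_exponent:
  fixes n :: nat
  assumes "r \<ge> 0"
  shows "real n powr (r + 1) / (r + 1) \<le> (\<Sum>m\<in>{1..n}. real m powr r)"
    and "(\<Sum>m\<in>{1..n}. real m powr r) \<le> (real n + 1) powr (r + 1) / (r + 1)"
proof (induction n)
  case (Suc n)
  {
    case 1
    have "(real n + 1) powr (r + 1) / (r + 1) - real n powr (r + 1) / (r + 1) \<le> (real n + 1) powr r"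
    \<comment> \<open>The mean value step needs a positive left end point; the first interval
      amounts to 1/(r+1) \<le> 1.\<close>
    proof (cases "n = 0")
      case False
      with powr_primitive_mvt[of r "real n"] assms obtain \<xi> where
        "real n < \<xi>" "\<xi> < real n + 1" "(real n + 1) powr (r + 1) / (r + 1) - real n powr (r + 1) / (r + 1) = \<xi> powr r"
        by auto
      thus ?thesis using assms by (simp add: powr_mono2)
    qed (use assms in auto)
    thus ?case using Suc.IH by (simp add: add.commute)
  next
    case 2
    from powr_primitive_mvt[of r "real n + 1"] assms obtain \<xi> where
      "real n + 1 < \<xi>" "\<xi> < real n + 1 + 1" "(real n + 1 + 1) powr (r + 1) / (r + 1) - (real n + 1) powr (r + 1) / (r + 1) = \<xi> powr r"
      by auto
    moreover from this have "(real n + 1) powr r \<le> \<xi> powr r" using assms by (intro powr_mono2) auto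
    ultimately show ?case using Suc.IH by (simp add: add.commute)
  }
qed (use assms in auto)

text \<open>For a decreasing summand both comparisons turn round. The lower one integrates from 1,
  and 1/(r+1) is the value of the primitive there.\<close>

lemma powr_sum_neg_exponent:
  fixes n :: nat
  assumes "-1 < r" "r < 0"
  shows "(real n + 1) powr (r + 1) / (r + 1) - 1 / (r + 1) \<le> (\<Sum>m\<in>{1..n}. real m powr r)"
    and "(\<Sum>m\<in>{1..n}. real m powr r) \<le> real n powr (r + 1) / (r + 1)"
proof (induction n)
  case (Suc n)
  {
    case 2
    have "(real n + 1) powr r \<le> (real n + 1) powr (r + 1) / (r + 1) - real n powr (r + 1) / (r + 1)"
    proof (cases "n = 0")
      case False
      with powr_primitive_mvt[of r "real n"] assms obtain \<xi> where
        "real n < \<xi>" "\<xi> < real n + 1" "(real n + 1) powr (r + 1) / (r + 1) - real n powr (r + 1) / (r + 1) = \<xi> powr r"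
        by auto
      thus ?thesis using assms by (simp add: powr_mono2')
    qed (use assms in auto)
    thus ?case using Suc.IH by (simp add: add.commute)
  next
    case 1
    from powr_primitive_mvt[of r "real n + 1"] assms obtain \<xi> where
      "real n + 1 < \<xi>" "\<xi> < real n + 1 + 1" "(real n + 1 + 1) powr (r + 1) / (r + 1) - (real n + 1) powr (r + 1) / (r + 1) = \<xi> powr r"
      by auto
    moreover from this have "\<xi> powr r \<le> (real n + 1) powr r" using assms by (intro powr_mono2') auto
    ultimately show ?case using Suc.IH by (simp add: add.commute)
  }
qed (use assms in auto)

text \<open>For y < 1 the sum is empty and the main term itself must be absorbed, hence \<beta>
  \<le> r + 1. For y \<ge> 1 the error is of order y^max(r,0), hence the two lower bounds on
  \<beta>.\<close>

lemma powr_sum_asymp: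
  assumes r: "r > -1" and \<beta>: "\<beta> \<ge> 0" "\<beta> \<ge> r" "\<beta> \<le> r + 1"
  shows "\<exists>C\<ge>0. \<forall>y>0. \<bar>powr_sum r y - y powr (r + 1) / (r + 1)\<bar> \<le> C * y powr \<beta>"
proof -
  \<comment> \<open>2^r pays for \<xi> < n + 1 \<le> 2y when r \<ge> 0; 1/(r+1) pays for y < 1 and
    for the bounded error when r < 0.\<close>
  define C where "C = 2 powr r + 1 / (r + 1)"
  have C: "C \<ge> 2 powr r" "C \<ge> 1 / (r + 1)" "C \<ge> 0" using r by (auto simp: C_def)
  have "\<bar>powr_sum r y - y powr (r + 1) / (r + 1)\<bar> \<le> C * y powr \<beta>" if y: "y > 0" for y
  proof (cases "y < 1")
    case True
    hence "nat \<lfloor>y\<rfloor> = 0" using y by simp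
    hence "\<bar>powr_sum r y - y powr (r + 1) / (r + 1)\<bar> = y powr (r + 1) / (r + 1)"
      using r by (simp add: powr_sum_def)
    also have "\<dots> \<le> y powr \<beta> / (r + 1)"
      using r \<beta> y True by (intro divide_right_mono powr_mono') auto
    also have "\<dots> \<le> C * y powr \<beta>" using mult_right_mono[OF C(2), of "y powr \<beta>"] by simp
    finally show ?thesis .
  next
    case False
    define n where "n = nat \<lfloor>y\<rfloor>"
    have n: "real n \<le> y" "y < real n + 1" "n \<ge> 1"
      using False by (auto simp: n_def le_nat_iff le_floor_iff)
    have Gn: "real n powr (r + 1) / (r + 1) \<le> y powr (r + 1) / (r + 1)"
      "y powr (r + 1) / (r + 1) \<le> (real n + 1) powr (r + 1) / (r + 1)"
      using n y r by (intro divide_right_mono powr_mono2; simp)+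
    have ps: "powr_sum r y = (\<Sum>m\<in>{1..n}. real m powr r)" by (simp add: powr_sum_def n_def)
    show ?thesis
    proof (cases "r \<ge> 0")
      case True
      from powr_primitive_mvt[of r "real n"] r n obtain \<xi> where
        \<xi>: "real n < \<xi>" "\<xi> < real n + 1" "(real n + 1) powr (r + 1) / (r + 1) - real n powr (r + 1) / (r + 1) = \<xi> powr r"
        by auto
      have "\<bar>powr_sum r y - y powr (r + 1) / (r + 1)\<bar> \<le> \<xi> powr r"
        using powr_sum_nonneg_exponent[OF True, of n] Gn \<xi>(3) unfolding ps by linarith
      also have "\<dots> \<le> (2 * y) powr r" using True \<xi> n by (intro powr_mono2) auto
      also have "\<dots> = 2 powr r * y powr r" using y by (simp add: powr_mult)
      also have "\<dots> \<le> C * y powr \<beta>" using C \<beta> False r by (intro mult_mono powr_mono) auto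
      finally show ?thesis .
    next
      case neg: False
      have "\<bar>powr_sum r y - y powr (r + 1) / (r + 1)\<bar> \<le> 1 / (r + 1)"
        using powr_sum_neg_exponent[OF r, of n] neg Gn unfolding ps by linarith
      also have "\<dots> \<le> C * 1" using C by simp
      also have "\<dots> \<le> C * y powr \<beta>"
        using \<beta> False r by (intro mult_left_mono ge_one_powr_ge_zero) (auto simp: C_def)
      finally show ?thesis .
    qed
  qed
  thus ?thesis using C(3) by blast
qed

lemma sum_multiples_powr:
  assumes d: "d \<ge> 1" and x: "x \<ge> 0"
  shows "(\<Sum>n | n \<in> {1..nat \<lfloor>x\<rfloor>} \<and> d dvd n. real n powr r) = real d powr r * powr_sum r (x / real d)"
proof -
  have le: "m \<le> nat \<lfloor>x / real d\<rfloor> \<longleftrightarrow> d * m \<le> nat \<lfloor>x\<rfloor>" for m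
    using d x by (simp add: le_nat_iff le_floor_iff field_simps)
  have "(\<Sum>n | n \<in> {1..nat \<lfloor>x\<rfloor>} \<and> d dvd n. real n powr r) = (\<Sum>m\<in>{1..nat \<lfloor>x / real d\<rfloor>}. real (d * m) powr r)"
  proof (rule sum.reindex_bij_witness[of _ "\<lambda>m. d * m" "\<lambda>n. n div d"])
    fix m assume "m \<in> {1..nat \<lfloor>x / real d\<rfloor>}"
    thus "d * m \<in> {n. n \<in> {1..nat \<lfloor>x\<rfloor>} \<and> d dvd n}"
      using le[of m] d by (simp add: Suc_le_eq)
  next
    fix n assume n: "n \<in> {n. n \<in> {1..nat \<lfloor>x\<rfloor>} \<and> d dvd n}"
    then obtain m where m: "n = d * m" by auto
    thus "n div d \<in> {1..nat \<lfloor>x / real d\<rfloor>}"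
      using le[of m] d n by (auto simp: Suc_le_eq)
  qed (use d in auto)
  also have "\<dots> = real d powr r * powr_sum r (x / real d)"
    by (simp add: powr_mult powr_sum_def sum_distrib_left)
  finally show ?thesis .
qed

section \<open>Divisor expansion of the generalized lcm and exchange of summation\<close>

text \<open>The product is admissible and divides every admissible \<open>d\<close>, so the least
  element for divisibility is also the numerical minimum.\<close>

lemma glcm_eq_prod:
  assumes b: "b \<ge> 1" and n: "n\<^sub>1 > 0" "n\<^sub>2 > 0"
  shows "glcm b n\<^sub>1 n\<^sub>2 =
    (\<Prod>p\<in>prime_factors (n\<^sub>1 * n\<^sub>2). p ^ cdiv b (max (multiplicity p n\<^sub>1) (multiplicity p n\<^sub>2)))"
    (is "_ = ?D")
proof -
  have D0: "?D > 0" by (rule prod_powers_pos) auto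
  have D: "multiplicity p ?D = cdiv b (max (multiplicity p n\<^sub>1) (multiplicity p n\<^sub>2))" if "prime p" for p
  proof (cases "p \<in> prime_factors (n\<^sub>1 * n\<^sub>2)")
    case False
    hence "pexp p (n\<^sub>1, n\<^sub>2) = (0, 0)" using pexp_eq_0[of "(n\<^sub>1, n\<^sub>2)" p] n that by simp
    thus ?thesis using False that b by (subst multiplicity_prod_powers) (auto simp: pexp_def)
  qed (use that in \<open>subst multiplicity_prod_powers; auto\<close>)
  have mp: "multiplicity p (d ^ b) = b * multiplicity p d" if "prime p" "d > 0" for p d :: nat
    using that by (intro prime_elem_multiplicity_power_distrib) auto
  show ?thesis unfolding glcm_def
  proof (rule Least_equality)
    have "multiplicity p n\<^sub>1 \<le> multiplicity p (?D ^ b) \<and> multiplicity p n\<^sub>2 \<le> multiplicity p (?D ^ b)"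
      if "prime p" for p
      unfolding mp[OF that D0] D[OF that]
      using mult_cdiv_ge[OF b, of "max (multiplicity p n\<^sub>1) (multiplicity p n\<^sub>2)"]
      by (simp add: mult.commute)
    hence "n\<^sub>1 dvd ?D ^ b" "n\<^sub>2 dvd ?D ^ b"
      using n by (auto intro!: multiplicity_le_imp_dvd)
    moreover have "1 \<le> ?D" using D0 by linarith
    ultimately show "1 \<le> ?D \<and> n\<^sub>1 dvd ?D ^ b \<and> n\<^sub>2 dvd ?D ^ b" by blast
  next
    fix d assume d: "1 \<le> d \<and> n\<^sub>1 dvd d ^ b \<and> n\<^sub>2 dvd d ^ b"
    hence d0: "d > 0" "d ^ b > 0" by auto
    have "multiplicity p ?D \<le> multiplicity p d" if "prime p" for p
    proof -
      have "multiplicity p n\<^sub>1 \<le> multiplicity p (d ^ b)" "multiplicity p n\<^sub>2 \<le> multiplicity p (d ^ b)"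
        using d d0 by (auto intro!: dvd_imp_multiplicity_le)
      thus ?thesis unfolding D[OF that] mp[OF that d0(1)]
        using b by (subst cdiv_le_iff) (auto simp: mult.commute)
    qed
    hence "?D dvd d" using D0 by (intro multiplicity_le_imp_dvd) auto
    thus "?D \<le> d" using d0 by (intro dvd_imp_le)
  qed
qed

text \<open>Here \<open>mult_fun (\<lambda>p. mixed_diff (local_quot b r p))\<close> is the function
  h of the overview.\<close>

lemma glcm_powr_eq:
  assumes b: "b \<ge> 1" and n: "n\<^sub>1 > 0" "n\<^sub>2 > 0"
  shows "real (glcm b n\<^sub>1 n\<^sub>2) powr r = (real n\<^sub>1 powr r * real n\<^sub>2 powr r) *
    (\<Sum>d\<in>{d. d dvd n\<^sub>1} \<times> {d. d dvd n\<^sub>2}. mult_fun (\<lambda>p. mixed_diff (local_quot b r p)) d)"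
proof -
  let ?F = "\<lambda>p e. real p powr (r * real (cdiv b (max (fst e) (snd e))))"
  have "real (glcm b n\<^sub>1 n\<^sub>2) powr r = mult_fun ?F (n\<^sub>1, n\<^sub>2)"
    unfolding glcm_eq_prod[OF assms] mult_fun_def of_nat_prod prod_powr_distrib
  proof (rule prod.cong)
    fix p assume "p \<in> prime_factors (fst (n\<^sub>1, n\<^sub>2) * snd (n\<^sub>1, n\<^sub>2))"
    hence "real p > 0" using prime_gt_0_nat by auto
    thus "real (p ^ cdiv b (max (multiplicity p n\<^sub>1) (multiplicity p n\<^sub>2))) powr r = ?F p (pexp p (n\<^sub>1, n\<^sub>2))"
      by (simp add: pexp_def powr_powr mult.commute flip: powr_realpow)
  qed auto
  also have "\<dots> = mult_fun (\<lambda>p e. real p powr (r * real (fst e + snd e))) (n\<^sub>1, n\<^sub>2) * mult_fun (local_quot b r) (n\<^sub>1, n\<^sub>2)"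
    by (rule mult_fun_mult) (simp add: local_quot_def powr_add[symmetric] algebra_simps)
  also have "mult_fun (\<lambda>p e. real p powr (r * real (fst e + snd e))) (n\<^sub>1, n\<^sub>2) = real n\<^sub>1 powr r * real n\<^sub>2 powr r"
    using n by (subst mult_fun_powr) (auto simp: powr_mult)
  also have "mult_fun (local_quot b r) (n\<^sub>1, n\<^sub>2) =
      (\<Sum>d\<in>{d. d dvd n\<^sub>1} \<times> {d. d dvd n\<^sub>2}. mult_fun (\<lambda>p. mixed_diff (local_quot b r p)) d)"
    by (rule mult_fun_divisor_sum[OF n])
      (use b in \<open>auto simp: sum_mixed_diff mixed_diff_local_quot_0 prime_gt_0_nat\<close>)
  finally show ?thesis .
qed

text \<open>A finite sum in disguise: M(x/d) = 0 once d > x. Writing it over all pairs allows a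
  termwise comparison with the series for the main constant.\<close>

lemma has_sum_glcm_power_sum:
  assumes b: "b \<ge> 1" and x: "x \<ge> 1"
  shows "((\<lambda>d. mult_fun (\<lambda>p. mixed_diff (local_quot b r p)) d * real (fst d * snd d) powr r *
            (powr_sum r (x / real (fst d)) * powr_sum r (x / real (snd d)))) has_sum glcm_power_sum b r x)
           ({1..} \<times> {1..})"
proof -
  define h where "h = mult_fun (\<lambda>p. mixed_diff (local_quot b r p))"
  define I where "I = {1..nat \<lfloor>x\<rfloor>}"
  have I_dvd: "a \<in> I" if "a dvd m" "m \<in> I" for a m
    using that dvd_imp_le[of a m] dvd_pos_nat[of m a] by (auto simp: I_def Suc_le_eq)
  let ?M = "\<lambda>d. powr_sum r (x / real d)"
  have "glcm_power_sum b r x =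
      (\<Sum>n\<in>I \<times> I. (real (fst n) powr r * real (snd n) powr r) * sum h ({d. d dvd fst n} \<times> {d. d dvd snd n}))"
    unfolding glcm_power_sum_def sum.cartesian_product I_def[symmetric]
    by (rule sum.cong) (auto simp: I_def h_def glcm_powr_eq[OF b])
  also have "\<dots> = (\<Sum>n\<in>I \<times> I. \<Sum>d | d \<in> I \<times> I \<and> fst d dvd fst n \<and> snd d dvd snd n.
      h d * (real (fst n) powr r * real (snd n) powr r))"
  proof (rule sum.cong)
    fix n assume n: "n \<in> I \<times> I"
    have "{d. d dvd fst n} \<times> {d. d dvd snd n} = {d. d \<in> I \<times> I \<and> fst d dvd fst n \<and> snd d dvd snd n}"
      using n I_dvd by auto
    thus "(real (fst n) powr r * real (snd n) powr r) * sum h ({d. d dvd fst n} \<times> {d. d dvd snd n}) =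
        (\<Sum>d | d \<in> I \<times> I \<and> fst d dvd fst n \<and> snd d dvd snd n. h d * (real (fst n) powr r * real (snd n) powr r))"
      by (simp add: sum_distrib_left mult.commute)
  qed auto
  also have "\<dots> = (\<Sum>d\<in>I \<times> I. \<Sum>n | n \<in> I \<times> I \<and> fst d dvd fst n \<and> snd d dvd snd n.
      h d * (real (fst n) powr r * real (snd n) powr r))"
    by (rule sum.swap_restrict) (auto simp: I_def)
  also have "\<dots> = (\<Sum>d\<in>I \<times> I. h d * real (fst d * snd d) powr r * (?M (fst d) * ?M (snd d)))"
  proof (rule sum.cong)
    fix d assume d: "d \<in> I \<times> I"
    have "{n. n \<in> I \<times> I \<and> fst d dvd fst n \<and> snd d dvd snd n} =
        {n. n \<in> I \<and> fst d dvd n} \<times> {n. n \<in> I \<and> snd d dvd n}" (is "?N = ?N1 \<times> ?N2") by auto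
    moreover have "(\<Sum>n\<in>?N1 \<times> ?N2. real (fst n) powr r * real (snd n) powr r) =
        (\<Sum>n\<in>?N1. real n powr r) * (\<Sum>n\<in>?N2. real n powr r)"
      by (simp add: sum_product sum.cartesian_product case_prod_beta)
    ultimately have "(\<Sum>n | n \<in> I \<times> I \<and> fst d dvd fst n \<and> snd d dvd snd n. h d * (real (fst n) powr r * real (snd n) powr r))
        = h d * ((\<Sum>n | n \<in> I \<and> fst d dvd n. real n powr r) * (\<Sum>n | n \<in> I \<and> snd d dvd n. real n powr r))"
      by (simp only: sum_distrib_left[symmetric])
    also have "\<dots> = h d * ((real (fst d) powr r * ?M (fst d)) * (real (snd d) powr r * ?M (snd d)))"
      unfolding I_def using d x by (subst (1 2) sum_multiples_powr) (auto simp: I_def)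
    finally show "(\<Sum>n | n \<in> I \<times> I \<and> fst d dvd fst n \<and> snd d dvd snd n. h d * (real (fst n) powr r * real (snd n) powr r))
        = h d * real (fst d * snd d) powr r * (?M (fst d) * ?M (snd d))"
      by (simp add: powr_mult mult_ac)
  qed auto
  finally have eq: "glcm_power_sum b r x = \<dots>" .
  have M0: "?M d = 0" if "d \<ge> 1" "d \<notin> I" for d
  proof -
    have "nat \<lfloor>x\<rfloor> < d" using that by (auto simp: I_def)
    hence "x < real d" using x by (metis floor_less_iff nat_less_iff of_int_of_nat_eq order_trans zero_le_floor zero_le_one)
    hence "x / real d < 1" using x by (simp add: divide_less_eq)
    hence "nat \<lfloor>x / real d\<rfloor> = 0" by simp
    thus ?thesis by (simp add: powr_sum_def)
  qed
  have "((\<lambda>d. h d * real (fst d * snd d) powr r * (?M (fst d) * ?M (snd d))) has_sum glcm_power_sum b r x) (I \<times> I)"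
    unfolding eq by (rule has_sum_finite) (simp add: I_def)
  also have "?this \<longleftrightarrow> ((\<lambda>d. h d * real (fst d * snd d) powr r * (?M (fst d) * ?M (snd d))) has_sum glcm_power_sum b r x) ({1..} \<times> {1..})"
  proof (rule has_sum_cong_neutral)
    fix d assume "d \<in> {1..} \<times> {1..} - I \<times> I"
    hence "fst d \<ge> 1" "snd d \<ge> 1" "fst d \<notin> I \<or> snd d \<notin> I" by auto
    hence "?M (fst d) = 0 \<or> ?M (snd d) = 0" using M0 by blast
    thus "h d * real (fst d * snd d) powr r * (?M (fst d) * ?M (snd d)) = 0" by auto
  qed (auto simp: I_def)
  finally show ?thesis unfolding h_def .
qed

section \<open>Summability of h and the main constant\<close>

lemma weighted_mult_fun:
  assumes "fst n > 0" "snd n > 0"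
  shows "mult_fun (\<lambda>p e. k p e * real p powr (s * real (fst e + snd e))) n =
    mult_fun k n * real (fst n * snd n) powr s"
  by (subst mult_fun_powr[OF assms, symmetric], rule mult_fun_mult) simp

lemma summable_weighted_mixed_diff:
  assumes b: "b \<ge> 1" and r: "r > -1" and \<delta>: "\<delta> > 0"
  shows "(\<lambda>d. mult_fun (\<lambda>p. mixed_diff (local_quot b r p)) d *
      real (fst d * snd d) powr - ((1 + max 0 (-r)) / 2 + \<delta>)) summable_on {1..} \<times> {1..}"
proof -
  define \<alpha> where "\<alpha> = (1 + max 0 (-r)) / 2 + \<delta>"
  obtain K where K: "K \<ge> 0" "\<And>p B. prime p \<Longrightarrow> finite B \<Longrightarrow>
    (\<Sum>e\<in>B. \<bar>mixed_diff (local_quot b r p) e * real p powr (- \<alpha> * real (fst e + snd e))\<bar>)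
      \<le> 1 + K * real p powr - (1 + 2 * \<delta>)"
    using sum_mixed_diff_local_quot_bound[OF b r \<delta>] unfolding \<alpha>_def by blast
  have "mult_fun (\<lambda>p e. mixed_diff (local_quot b r p) e * real p powr (- \<alpha> * real (fst e + snd e)))
      summable_on {1..} \<times> {1..}"
  proof (rule mult_fun_summable_on[OF _ _ K])
    show "mixed_diff (local_quot b r p) (0, 0) * real p powr (- \<alpha> * real (fst (0, 0) + snd (0, 0))) = 1"
      if "prime p" for p
      using mixed_diff_local_quot_0[OF b, of p r] prime_gt_0_nat[OF that] by simp
  qed (use \<delta> in auto)
  also have "?this \<longleftrightarrow> (\<lambda>d. mult_fun (\<lambda>p. mixed_diff (local_quot b r p)) d * real (fst d * snd d) powr - \<alpha>)
      summable_on {1..} \<times> {1..}"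
    by (rule summable_on_cong, rule weighted_mult_fun) auto
  finally show ?thesis unfolding \<alpha>_def .
qed

text \<open>The partial products of the local factors have two limits, the sum over all pairs and
  the infinite product; uniqueness of limits identifies them.\<close>

lemma has_sum_glcm_const:
  assumes b: "b \<ge> 2" and r: "r > -1"
  shows "((\<lambda>d. mult_fun (\<lambda>p. mixed_diff (local_quot b r p)) d * real (fst d * snd d) powr - 1) has_sum
      glcm_const b r) ({1..} \<times> {1..})"
proof -
  \<comment> \<open>the choice of \<open>\<delta>\<close> for which the weight \<open>\<alpha>\<close> of \<open>sum_mixed_diff_local_quot_bound\<close> is 1\<close>
  define \<delta> where "\<delta> = (1 - max 0 (-r)) / 2"
  have \<delta>: "\<delta> > 0" using r by (auto simp: \<delta>_def)
  have \<alpha>: "(1 + max 0 (-r)) / 2 + \<delta> = 1" by (simp add: \<delta>_def field_simps)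
  have b1: "b \<ge> 1" using b by simp
  define k where "k = (\<lambda>p e. mixed_diff (local_quot b r p) e * real p powr (- 1 * real (fst e + snd e)))"
  define s1 where "s1 = (r + 1) * real b - r"
  define s2 where "s2 = 2 * (r + 1) * real b - r"
  have rb: "(r + 1) * real b \<ge> (r + 1) * 2" using assms by (intro mult_left_mono) auto
  have s: "s1 > 1" "s2 > 1" using rb r by (auto simp: s1_def s2_def algebra_simps)
  define E where "E = (\<lambda>s p. if prime p then 1 / (1 - 1 / real p powr s) else 1)"
  define T where "T = (\<lambda>p. if prime p then (1 / (1 - 1 / real p powr (r + 1))) ^ 2 *
                    ((1 - 1 / real p) ^ 2 * prime_bracket b r p) else 1)"
  define L where "L = (\<lambda>p. if prime p then infsum (k p) UNIV else 1)"
  have hs: "(k p has_sum (E s1 p * E s2 p * T p)) UNIV" if "prime p" for p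
    using has_sum_local_factor[OF b r that] that unfolding k_def E_def T_def s1_def s2_def by simp
  have L: "L p = E s1 p * E s2 p * T p" for p
    using infsumI[OF hs, of p] by (auto simp: L_def E_def T_def)
  have k0: "k p (0, 0) = 1" if "prime p" for p
    using mixed_diff_local_quot_0[OF b1, of p r] prime_gt_0_nat[OF that] by (simp add: k_def)
  obtain K where K: "K \<ge> 0" "\<And>p B. prime p \<Longrightarrow> finite B \<Longrightarrow>
      (\<Sum>e\<in>B. \<bar>k p e\<bar>) \<le> 1 + K * real p powr - (1 + 2 * \<delta>)"
    using sum_mixed_diff_local_quot_bound[OF b1 r \<delta>] unfolding \<alpha> k_def by blast
  have sm: "mult_fun k summable_on {1..} \<times> {1..}"
    by (rule mult_fun_summable_on[OF k0 _ K]) (use \<delta> in auto)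
  have "(\<lambda>N. \<Prod>p\<le>N. L p) \<longlonglongrightarrow> infsum (mult_fun k) ({1..} \<times> {1..})"
    unfolding L_def by (rule mult_fun_euler_product[OF k0 _ sm]) (use hs in \<open>auto simp: summable_on_def\<close>)
  moreover have Lb: "norm (L p - 1) \<le> K * real p powr - (1 + 2 * \<delta>)" for p
  proof (cases "prime p")
    case True
    have "(k p has_sum (L p - k p (0, 0))) (UNIV - {(0, 0)})"
      unfolding L by (intro has_sum_Diff hs True) (auto intro: has_sum_finiteI)
    hence 1: "(k p has_sum (L p - 1)) (UNIV - {(0, 0)})" using k0[OF True] by simp
    \<comment> \<open>Inserting (0, 0), whose term is exactly 1, turns the bound 1 + K
      p^(-(1+2\<delta>)) into a bound for the remaining terms.\<close>
    have bd: "(\<Sum>e\<in>F. \<bar>k p e\<bar>) \<le> K * real p powr - (1 + 2 * \<delta>)"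
      if "finite F" "F \<subseteq> UNIV - {(0, 0)}" for F
    proof -
      have "(\<Sum>e\<in>insert (0, 0) F. \<bar>k p e\<bar>) = 1 + (\<Sum>e\<in>F. \<bar>k p e\<bar>)"
        using that k0[OF True] by (subst sum.insert) auto
      thus ?thesis using K(2)[OF True, of "insert (0, 0) F"] that by simp
    qed
    have "L p - 1 \<le> K * real p powr - (1 + 2 * \<delta>)"
      by (rule has_sum_le_finite_sums[OF 1], rule order.trans[OF _ bd], rule sum_mono) auto
    moreover have 2: "((\<lambda>e. - k p e) has_sum - (L p - 1)) (UNIV - {(0, 0)})"
      using 1 by (simp add: has_sum_uminus)
    have "- (L p - 1) \<le> K * real p powr - (1 + 2 * \<delta>)"
      by (rule has_sum_le_finite_sums[OF 2], rule order.trans[OF _ bd], rule sum_mono) auto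
    ultimately show ?thesis by simp
  qed (use K(1) in \<open>simp add: L_def\<close>)
  have "summable (\<lambda>p. K * real p powr - (1 + 2 * \<delta>))"
    using \<delta> by (intro summable_mult) (simp add: summable_real_powr_iff)
  hence "summable (\<lambda>p. norm (L p - 1))"
    by (rule summable_comparison_test_ev[rotated]) (use Lb in \<open>auto intro!: always_eventually\<close>)
  hence cL: "convergent_prod L"
    by (intro abs_convergent_prod_imp_convergent_prod summable_imp_abs_convergent_prod)
  hence "(\<lambda>N. \<Prod>p\<le>N. L p) \<longlonglongrightarrow> prodinf L" by (rule convergent_prod_LIMSEQ)
  ultimately have H: "infsum (mult_fun k) ({1..} \<times> {1..}) = prodinf L" by (rule LIMSEQ_unique)
  have E: "E s1 has_prod zeta s1" "E s2 has_prod zeta s2"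
    unfolding E_def by (intro zeta_euler_product s)+
  have E0: "E s1 p * E s2 p \<noteq> 0" for p
    using prime_powr_less_1[of p s1] prime_powr_less_1[of p s2] s by (auto simp: E_def)
  have EE: "(\<lambda>p. E s1 p * E s2 p) has_prod (zeta s1 * zeta s2)" by (intro has_prod_mult E)
  \<comment> \<open>Convergence of the bracket product is inherited: the full local factors and the
    zeta factors converge, so their quotient does. This covers r \<le> 0 and r > 0
    uniformly.\<close>
  have "convergent_prod (\<lambda>p. L p / (E s1 p * E s2 p))"
    using cL EE by (intro convergent_prod_divide) (auto simp: has_prod_iff)
  also have "(\<lambda>p. L p / (E s1 p * E s2 p)) = T" using E0 by (auto simp: L)
  finally have cT: "convergent_prod T" .
  have "prodinf L = (\<Prod>p. E s1 p * E s2 p * T p)" by (subst L[THEN ext]) (rule refl)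
  also have "\<dots> = zeta s1 * zeta s2 * prodinf T"
    using prodinf_mult[OF _ cT, of "\<lambda>p. E s1 p * E s2 p"] EE by (simp add: has_prod_iff)
  also have "\<dots> = glcm_const b r"
    unfolding glcm_const_eq[OF b r] T_def s1_def s2_def ..
  finally have "(mult_fun k has_sum glcm_const b r) ({1..} \<times> {1..})"
    using sm H by (simp add: has_sum_iff)
  also have "?this \<longleftrightarrow> ?thesis" unfolding k_def
    by (rule has_sum_cong, rule weighted_mult_fun) auto
  finally show ?thesis .
qed

section \<open>The asymptotic formula\<close>

theorem corollary1:
  fixes b :: nat and r \<epsilon> :: real
  assumes "b \<ge> 2" and "r > -1" and "\<epsilon> > 0"
  shows "(\<lambda>x::real. glcm_power_sum b r x
            - glcm_const b r * (x powr (2 * (r + 1)) / (r + 1) ^ 2))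
         \<in> O[at_top](\<lambda>x. x powr (2 * (r + 1) - 1 / 2 * min (r + 1) 1 + \<epsilon>))"
proof -
  note b = assms(1) and r = assms(2)
  define \<theta> where "\<theta> = 1 / 2 * min (r + 1) 1"
  \<comment> \<open>Capping \<epsilon> at \<theta> guarantees \<alpha> \<le> 1, that is \<beta>
    \<le> r + 1.\<close>
  define \<delta> where "\<delta> = min \<epsilon> \<theta>"
  define \<alpha> where "\<alpha> = 1 - \<theta> + \<delta>"
  \<comment> \<open>Chosen so that (d1 d2)^r (d1 d2)^(-\<beta>) = (d1 d2)^(-\<alpha>), the weight
    for which h is summable; then r + 1 + \<beta> = 2(r+1) - \<theta> + \<delta>.\<close>
  define \<beta> where "\<beta> = r + \<alpha>"
  have b1: "b \<ge> 1" using b by simp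
  have \<theta>: "\<theta> > 0" using r by (auto simp: \<theta>_def)
  have \<delta>: "\<delta> > 0" "\<delta> \<le> \<theta>" "\<delta> \<le> \<epsilon>" using \<theta> assms(3) by (auto simp: \<delta>_def)
  have \<alpha>: "\<alpha> = (1 + max 0 (-r)) / 2 + \<delta>" by (auto simp: \<alpha>_def \<theta>_def min_def max_def field_simps)
  have \<beta>: "\<beta> \<ge> 0" "\<beta> \<ge> r" "\<beta> \<le> r + 1"
  proof -
    have "\<theta> \<le> r + 1" "\<theta> \<le> 1" using r by (auto simp: \<theta>_def min_def)
    thus "\<beta> \<ge> 0" "\<beta> \<ge> r" "\<beta> \<le> r + 1" using \<delta> by (auto simp: \<beta>_def \<alpha>_def)
  qed
  define h where "h = mult_fun (\<lambda>p. mixed_diff (local_quot b r p))"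
  define G where "G = (\<lambda>y. y powr (r + 1) / (r + 1))"
  let ?P = "{1..} \<times> {1..} :: (nat \<times> nat) set"
  obtain C where C: "C \<ge> 0" "\<And>y. y > 0 \<Longrightarrow> \<bar>powr_sum r y - G y\<bar> \<le> C * y powr \<beta>"
    using powr_sum_asymp[OF r \<beta>] unfolding G_def by blast
  \<comment> \<open>2C/(r+1) collects the two cross terms main times error, and C^2 the product of
    the two errors.\<close>
  define C' where "C' = 2 * C / (r + 1) + C ^ 2"
  define w where "w = (\<lambda>d. \<bar>h d\<bar> * real (fst d * snd d) powr - \<alpha>)"
  have "(\<lambda>d. norm (h d * real (fst d * snd d) powr - \<alpha>)) summable_on ?P"
    unfolding summable_on_iff_abs_summable_on_real[symmetric]
    using summable_weighted_mixed_diff[OF b1 r \<delta>(1)] unfolding \<alpha> h_def .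
  hence w: "w summable_on ?P" unfolding w_def by (simp add: abs_mult)
  have bound: "\<bar>glcm_power_sum b r x - glcm_const b r * (x powr (2 * (r + 1)) / (r + 1) ^ 2)\<bar>
      \<le> C' * infsum w ?P * x powr (2 * (r + 1) - \<theta> + \<epsilon>)" if x: "x \<ge> 1" for x
  proof -
    let ?M = "\<lambda>d. powr_sum r (x / real d)" and ?G = "\<lambda>d. G (x / real d)"
    define X where "X = x powr (2 * (r + 1))"
    have S: "((\<lambda>d. h d * real (fst d * snd d) powr r * (?M (fst d) * ?M (snd d))) has_sum glcm_power_sum b r x) ?P"
      using has_sum_glcm_power_sum[OF b1 x] unfolding h_def .
    have "((\<lambda>d. h d * real (fst d * snd d) powr - 1 * (X / (r + 1) ^ 2)) has_sum
        glcm_const b r * (X / (r + 1) ^ 2)) ?P"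
      unfolding h_def by (intro has_sum_cmult_left has_sum_glcm_const b r)
    also have "?this \<longleftrightarrow> ((\<lambda>d. h d * real (fst d * snd d) powr r * (?G (fst d) * ?G (snd d))) has_sum
        glcm_const b r * (X / (r + 1) ^ 2)) ?P"
    proof (rule has_sum_cong)
      fix d assume d: "d \<in> ?P"
      have "real (fst d * snd d) powr r * (?G (fst d) * ?G (snd d)) =
          (x * x) powr (r + 1) * (real (fst d * snd d) powr r / real (fst d * snd d) powr (r + 1)) / (r + 1) ^ 2"
        using x by (simp add: G_def powr_divide powr_mult power2_eq_square mult_ac)
      also have "(x * x) powr (r + 1) = X"
        using x by (simp add: X_def powr_mult powr_add[symmetric])
      also have "real (fst d * snd d) powr r / real (fst d * snd d) powr (r + 1) = real (fst d * snd d) powr - 1"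
        by (simp add: powr_diff[symmetric])
      finally show "h d * real (fst d * snd d) powr - 1 * (X / (r + 1) ^ 2) =
          h d * real (fst d * snd d) powr r * (?G (fst d) * ?G (snd d))"
        by (simp add: mult.assoc mult.commute)
    qed
    finally have main: "((\<lambda>d. h d * real (fst d * snd d) powr r * (?G (fst d) * ?G (snd d))) has_sum
        glcm_const b r * (X / (r + 1) ^ 2)) ?P" .
    have "((\<lambda>d. h d * real (fst d * snd d) powr r * (?M (fst d) * ?M (snd d)) +
            - (h d * real (fst d * snd d) powr r * (?G (fst d) * ?G (snd d)))) has_sum
        (glcm_power_sum b r x + - (glcm_const b r * (X / (r + 1) ^ 2)))) ?P"
      using main by (intro has_sum_add S) (simp add: has_sum_uminus)
    moreover have "((\<lambda>d. C' * x powr (r + 1 + \<beta>) * w d) has_sum (C' * x powr (r + 1 + \<beta>) * infsum w ?P)) ?P"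
      by (intro has_sum_cmult_right has_sum_infsum w)
    ultimately have "norm (glcm_power_sum b r x + - (glcm_const b r * (X / (r + 1) ^ 2)))
        \<le> C' * x powr (r + 1 + \<beta>) * infsum w ?P"
    proof (rule norm_infsum_le)
      fix d assume "d \<in> ?P"
      then obtain d\<^sub>1 d\<^sub>2 where d: "d = (d\<^sub>1, d\<^sub>2)" "d\<^sub>1 \<ge> 1" "d\<^sub>2 \<ge> 1" by auto
      define Y where "Y = x powr (r + 1)"
      define Z where "Z = x powr \<beta>"
      define D where "D = (\<lambda>m::nat. real m powr - \<beta>)"
      have ZY: "0 \<le> Z" "Z \<le> Y" using x \<beta> by (auto simp: Z_def Y_def intro: powr_mono)
      have D0: "D m \<ge> 0" for m by (simp add: D_def)
      \<comment> \<open>The true decay m^(-(r+1)) is weakened to m^(-\<beta>), so that main and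
        error factors carry the same weight \<open>D\<close>.\<close>
      have Gb: "0 \<le> ?G m \<and> ?G m \<le> Y * D m / (r + 1)" if "m \<ge> 1" for m
      proof -
        have "real m powr - (r + 1) \<le> D m" unfolding D_def using that \<beta> by (intro powr_mono) auto
        hence "Y * real m powr - (r + 1) / (r + 1) \<le> Y * D m / (r + 1)"
          using r by (intro divide_right_mono mult_left_mono) (auto simp: Y_def)
        moreover have "?G m = Y * real m powr - (r + 1) / (r + 1)"
          unfolding G_def Y_def powr_minus_divide[of _ "r + 1"] using x by (simp add: powr_divide)
        moreover have "?G m \<ge> 0" using r by (simp add: G_def)
        ultimately show ?thesis by simp
      qed
      have Eb: "\<bar>?M m - ?G m\<bar> \<le> C * (Z * D m)" if "m \<ge> 1" for m
      proof -
        have "\<bar>?M m - ?G m\<bar> \<le> C * (x / real m) powr \<beta>" using that x by (intro C) auto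
        also have "(x / real m) powr \<beta> = Z * D m"
          unfolding Z_def D_def powr_minus_divide using x by (simp add: powr_divide)
        finally show ?thesis .
      qed
      have "\<bar>?M d\<^sub>1 * ?M d\<^sub>2 - ?G d\<^sub>1 * ?G d\<^sub>2\<bar> =
          \<bar>(?M d\<^sub>1 - ?G d\<^sub>1) * ?G d\<^sub>2 + ?G d\<^sub>1 * (?M d\<^sub>2 - ?G d\<^sub>2) + (?M d\<^sub>1 - ?G d\<^sub>1) * (?M d\<^sub>2 - ?G d\<^sub>2)\<bar>"
        by (simp add: algebra_simps)
      also have "\<dots> \<le> \<bar>?M d\<^sub>1 - ?G d\<^sub>1\<bar> * \<bar>?G d\<^sub>2\<bar> + \<bar>?G d\<^sub>1\<bar> * \<bar>?M d\<^sub>2 - ?G d\<^sub>2\<bar> + \<bar>?M d\<^sub>1 - ?G d\<^sub>1\<bar> * \<bar>?M d\<^sub>2 - ?G d\<^sub>2\<bar>"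
        unfolding abs_mult[symmetric] by linarith
      also have "\<dots> \<le> (C * (Z * D d\<^sub>1)) * (Y * D d\<^sub>2 / (r + 1)) + (Y * D d\<^sub>1 / (r + 1)) * (C * (Z * D d\<^sub>2))
          + (C * (Z * D d\<^sub>1)) * (C * (Y * D d\<^sub>2))"
      proof (intro add_mono mult_mono)
        have "\<bar>?M d\<^sub>2 - ?G d\<^sub>2\<bar> \<le> C * (Z * D d\<^sub>2)" by (rule Eb[OF d(3)])
        \<comment> \<open>In the product of two errors one factor x^\<beta> is enlarged to x^(r+1),
          giving it the shape of the cross terms.\<close>
        also have "\<dots> \<le> C * (Y * D d\<^sub>2)" using C ZY D0 by (intro mult_left_mono mult_right_mono)
        finally show "\<bar>?M d\<^sub>2 - ?G d\<^sub>2\<bar> \<le> C * (Y * D d\<^sub>2)" .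
      qed (use Eb[OF d(2)] Eb[OF d(3)] Gb[OF d(2)] Gb[OF d(3)] C ZY D0 r in \<open>auto simp: mult_nonneg_nonneg\<close>)
      also have "\<dots> = C' * (Y * Z) * (D d\<^sub>1 * D d\<^sub>2)"
        by (simp add: C'_def power2_eq_square algebra_simps add_divide_distrib)
      also have "Y * Z = x powr (r + 1 + \<beta>)" by (simp add: Y_def Z_def powr_add)
      also have "D d\<^sub>1 * D d\<^sub>2 = real (fst d * snd d) powr - \<beta>" by (simp add: D_def d powr_mult)
      finally have le: "\<bar>?M d\<^sub>1 * ?M d\<^sub>2 - ?G d\<^sub>1 * ?G d\<^sub>2\<bar> \<le> C' * x powr (r + 1 + \<beta>) * real (fst d * snd d) powr - \<beta>" .
      have "norm (h d * real (fst d * snd d) powr r * (?M (fst d) * ?M (snd d)) +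
            - (h d * real (fst d * snd d) powr r * (?G (fst d) * ?G (snd d)))) =
          \<bar>h d\<bar> * real (fst d * snd d) powr r * \<bar>?M d\<^sub>1 * ?M d\<^sub>2 - ?G d\<^sub>1 * ?G d\<^sub>2\<bar>"
      proof -
        have "h d * real (fst d * snd d) powr r * (?M (fst d) * ?M (snd d)) +
            - (h d * real (fst d * snd d) powr r * (?G (fst d) * ?G (snd d))) =
            h d * real (fst d * snd d) powr r * (?M d\<^sub>1 * ?M d\<^sub>2 - ?G d\<^sub>1 * ?G d\<^sub>2)"
          by (simp add: d right_diff_distrib)
        thus ?thesis by (simp only: real_norm_def abs_mult abs_of_nonneg[OF powr_ge_zero])
      qed
      also have "\<dots> \<le> \<bar>h d\<bar> * real (fst d * snd d) powr r * (C' * x powr (r + 1 + \<beta>) * real (fst d * snd d) powr - \<beta>)"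
        by (rule mult_left_mono[OF le]) simp
      also have "\<dots> = C' * x powr (r + 1 + \<beta>) * (\<bar>h d\<bar> * (real (fst d * snd d) powr r * real (fst d * snd d) powr - \<beta>))"
        by (simp only: mult_ac)
      also have "real (fst d * snd d) powr r * real (fst d * snd d) powr - \<beta> = real (fst d * snd d) powr - \<alpha>"
        unfolding powr_add[symmetric] \<beta>_def by simp
      finally show "norm (h d * real (fst d * snd d) powr r * (?M (fst d) * ?M (snd d)) +
            - (h d * real (fst d * snd d) powr r * (?G (fst d) * ?G (snd d)))) \<le> C' * x powr (r + 1 + \<beta>) * w d"
        unfolding w_def .
    qed
    also have "\<dots> \<le> C' * x powr (2 * (r + 1) - \<theta> + \<epsilon>) * infsum w ?P"
    proof (intro mult_right_mono mult_left_mono powr_mono)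
      show "r + 1 + \<beta> \<le> 2 * (r + 1) - \<theta> + \<epsilon>" using \<delta> by (simp add: \<beta>_def \<alpha>_def)
      show "infsum w ?P \<ge> 0" by (rule infsum_nonneg) (simp add: w_def)
      show "C' \<ge> 0" using C r by (simp add: C'_def)
    qed (use x in auto)
    finally show ?thesis by (simp add: X_def mult_ac)
  qed
  show ?thesis unfolding \<theta>_def[symmetric]
  proof (rule bigoI)
    show "eventually (\<lambda>x. norm (glcm_power_sum b r x - glcm_const b r * (x powr (2 * (r + 1)) / (r + 1) ^ 2))
        \<le> C' * infsum w ?P * norm (x powr (2 * (r + 1) - \<theta> + \<epsilon>))) at_top"
      using eventually_ge_at_top[of "1::real"] by eventually_elim (use bound in simp)
  qed
qed

end
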